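(* Let $n\ge 2$ and let $C$ be a mutation cycle of $n$-vertex quivers, based at $Q$ with mutation sequence $i_1,\dots,i_N$, such that every quiver along the cycle has large weights. Then $C$ does not underlie a mutation cycle of seeds in the associated cluster algebra, with arbitrary coefficients: for any seed $(\mathbf{x},\mathbf{y},B(Q))$, applying the seed mutations $\mu_{i_1},\dots,\mu_{i_N}$ in this order does not return the same seed. In particular, for $n\ge4$, $k>0$, a quiver $\tilde R$ on $[1,n-1]$ with $b_{ij}(\tilde R)\ge 2$ for $i<j$, and $Q$ the quiver on $[1,n]$ whose full subquiver on $[1,n-1]$ is obtained from $\tilde R$ by mutating successively at $2,1,\dots,2,1$ ($2k$ mutations, starting with $2$) and with arbitrary $b_{in}(Q)\ge 2$, the mutation cycle based at $Q$ given by mutating successively at $n,\ 1,2,\dots,1,2\ (2k\text{ terms}),\ n-1,\dots,2,1,\ 2,1,\dots,2,1\ (2k\text{ terms})$ is never a mutation cycle of seeds.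
   Context: A quiver on $[1,n]$ is a finite directed multigraph with no loops and no oriented 2-cycles, encoded by the skew-symmetric matrix $B(Q)=(b_{ij})$; matrix mutation at $k$: $b'_{ij}=-b_{ij}$ if $k\in\{i,j\}$, else $b'_{ij}=b_{ij}+\tfrac12(|b_{ik}|b_{kj}+b_{ik}|b_{kj}|)$. $Q$ has large weights if $|b_{ij}|\ge 2$ for all $i\ne j$. A mutation cycle of length $N$ based at $Q$ is a sequence $i_1,\dots,i_N$ with consecutive entries distinct (cyclically), no mutation at an isolated vertex, such that successive mutations at $i_1,\dots,i_N$ return $Q$. Seeds with arbitrary coefficients: fix a semifield $(\mathbb{P},\oplus,\cdot)$ and a field $\mathcal F$ of rational functions in $n$ variables over the field of fractions of $\mathbb{Z}\mathbb{P}$. A seed is a triple $(\mathbf{x},\mathbf{y},B)$ with $\mathbf{x}=(x_1,\dots,x_n)$ a free generating set of $\mathcal F$, $\mathbf{y}=(y_1,\dots,y_n)\in\mathbb{P}^n$, $B$ skew-symmetric. Seed mutation $\mu_k$ replaces $B$ by its matrix mutation, replaces $x_k$ by $x_k'=\dfrac{y_k\prod_i x_i^{[b_{ik}]_+}+\prod_i x_i^{[-b_{ik}]_+}}{(y_k\oplus 1)\,x_k}$ (other $x_j$ unchanged), and replaces $y_j$ by $y_k^{-1}$ if $j=k$ and by $y_jy_k^{[b_{kj}]_+}(y_k\oplus1)^{-b_{kj}}$ otherwise, where $[t]_+=\max(t,0)$. Two seeds are the same if their clusters coincide as labeled tuples and the coefficient tuples and matrices coincide. *)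

theory Defs
  imports Complex_Main "HOL-Library.Poly_Mapping"
begin

(* Quivers on [1,n], identified with their skew-symmetric integer matrices: B i j is the number of
   arrows from i to j minus the number of arrows from j to i.  Only the entries with both indices
   in {1..n} are meaningful, so matrices (and all n-tuples below) are compared on {1..n} only. *)

definition quiver :: "nat \<Rightarrow> (nat \<Rightarrow> nat \<Rightarrow> int) \<Rightarrow> bool" where
  "quiver n B \<longleftrightarrow> (\<forall>i\<in>{1..n}. \<forall>j\<in>{1..n}. B i j = - B j i)"

definition same_quiver :: "nat \<Rightarrow> (nat \<Rightarrow> nat \<Rightarrow> int) \<Rightarrow> (nat \<Rightarrow> nat \<Rightarrow> int) \<Rightarrow> bool" where
  "same_quiver n B B' \<longleftrightarrow> (\<forall>i\<in>{1..n}. \<forall>j\<in>{1..n}. B i j = B' i j)"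

(* The division by 2 is exact: the summands are equal up to a sign. *)
definition mutate :: "nat \<Rightarrow> (nat \<Rightarrow> nat \<Rightarrow> int) \<Rightarrow> nat \<Rightarrow> nat \<Rightarrow> int" where
  "mutate k B i j =
     (if i = k \<or> j = k then - B i j
      else B i j + (\<bar>B i k\<bar> * B k j + B i k * \<bar>B k j\<bar>) div 2)"

(* The head of the list is mutated first. *)
definition mutates :: "nat list \<Rightarrow> (nat \<Rightarrow> nat \<Rightarrow> int) \<Rightarrow> nat \<Rightarrow> nat \<Rightarrow> int" where
  "mutates ks B = fold mutate ks B"

definition large_weights :: "nat \<Rightarrow> (nat \<Rightarrow> nat \<Rightarrow> int) \<Rightarrow> bool" where
  "large_weights n B \<longleftrightarrow> (\<forall>i\<in>{1..n}. \<forall>j\<in>{1..n}. i \<noteq> j \<longrightarrow> \<bar>B i j\<bar> \<ge> 2)"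

definition isolated :: "nat \<Rightarrow> (nat \<Rightarrow> nat \<Rightarrow> int) \<Rightarrow> nat \<Rightarrow> bool" where
  "isolated n B k \<longleftrightarrow> (\<forall>j\<in>{1..n}. B k j = 0)"

definition mutation_cycle :: "nat \<Rightarrow> (nat \<Rightarrow> nat \<Rightarrow> int) \<Rightarrow> nat list \<Rightarrow> bool" where
  "mutation_cycle n Q ks \<longleftrightarrow>
     quiver n Q \<and> ks \<noteq> [] \<and> set ks \<subseteq> {1..n} \<and>
     (\<forall>m<length ks. ks ! m \<noteq> ks ! (Suc m mod length ks)) \<and>
     (\<forall>m<length ks. \<not> isolated n (mutates (take m ks) Q) (ks ! m)) \<and>
     same_quiver n (mutates ks Q) Q"

definition large_weights_along :: "nat \<Rightarrow> (nat \<Rightarrow> nat \<Rightarrow> int) \<Rightarrow> nat list \<Rightarrow> bool" where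
  "large_weights_along n Q ks \<longleftrightarrow>
     (\<forall>m\<le>length ks. large_weights n (mutates (take m ks) Q))"

(* A semifield: an abelian multiplicative group with an auxiliary addition that is commutative,
   associative and distributive; there is no zero.  The auxiliary addition is written +. *)
class semifield = comm_semiring + comm_monoid_mult + inverse +
  assumes semifield_left_inverse: "inverse a * a = 1"
    and semifield_divide: "a / b = a * inverse b"

(* Elements of the group ring Z[P] are finitely supported functions from P to the integers.  For a
   map emb from P to a field, zp_embed is its additive extension to Z[P]; it is a ring homomorphism
   whenever emb is multiplicative and unital. *)
definition zp_embed :: "('p \<Rightarrow> 'f::field) \<Rightarrow> ('p \<Rightarrow>\<^sub>0 int) \<Rightarrow> 'f" where
  "zp_embed emb a = (\<Sum>p\<in>Poly_Mapping.keys a. of_int (Poly_Mapping.lookup a p) * emb p)"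

(* The copy of the field of fractions of Z[P] inside the ambient field. *)
definition zp_fractions :: "('p \<Rightarrow> 'f::field) \<Rightarrow> 'f set" where
  "zp_fractions emb = {zp_embed emb a / zp_embed emb b | a b. b \<noteq> 0}"

(* Polynomials over K in the variables indexed by {1..n}: finitely supported families of
   coefficients, indexed by exponent vectors, and their value at a tuple x. *)
definition polynomials :: "nat \<Rightarrow> 'f::field set \<Rightarrow> ((nat \<Rightarrow>\<^sub>0 nat) \<Rightarrow>\<^sub>0 'f) set" where
  "polynomials n K =
     {p. \<forall>m\<in>Poly_Mapping.keys p. Poly_Mapping.keys m \<subseteq> {1..n} \<and> Poly_Mapping.lookup p m \<in> K}"

definition poly_value :: "((nat \<Rightarrow>\<^sub>0 nat) \<Rightarrow>\<^sub>0 'f::field) \<Rightarrow> (nat \<Rightarrow> 'f) \<Rightarrow> 'f" where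
  "poly_value p x =
     (\<Sum>m\<in>Poly_Mapping.keys p. Poly_Mapping.lookup p m *
        (\<Prod>i\<in>Poly_Mapping.keys m. x i ^ Poly_Mapping.lookup m i))"

definition algebraically_independent :: "nat \<Rightarrow> 'f::field set \<Rightarrow> (nat \<Rightarrow> 'f) \<Rightarrow> bool" where
  "algebraically_independent n K x \<longleftrightarrow>
     (\<forall>p\<in>polynomials n K. poly_value p x = 0 \<longrightarrow> p = 0)"

(* x 1, ..., x n are algebraically independent over K and generate the whole field over K. *)
definition free_generating_set :: "nat \<Rightarrow> 'f::field set \<Rightarrow> (nat \<Rightarrow> 'f) \<Rightarrow> bool" where
  "free_generating_set n K x \<longleftrightarrow>
     algebraically_independent n K x \<and>
     (\<forall>f. \<exists>p\<in>polynomials n K. \<exists>q\<in>polynomials n K.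
        poly_value q x \<noteq> 0 \<and> f = poly_value p x / poly_value q x)"

(* The type 'f is a field of rational functions in n variables over the field of fractions of Z[P],
   where P is embedded by emb. *)
definition ambient_field :: "nat \<Rightarrow> ('p::semifield \<Rightarrow> 'f::field) \<Rightarrow> bool" where
  "ambient_field n emb \<longleftrightarrow>
     emb 1 = 1 \<and> (\<forall>p q. emb (p * q) = emb p * emb q) \<and> inj (zp_embed emb) \<and>
     (\<exists>z. free_generating_set n (zp_fractions emb) z)"

type_synonym ('p, 'f) seed = "(nat \<Rightarrow> 'f) \<times> (nat \<Rightarrow> 'p) \<times> (nat \<Rightarrow> nat \<Rightarrow> int)"

definition is_seed :: "nat \<Rightarrow> ('p::semifield \<Rightarrow> 'f::field) \<Rightarrow> ('p, 'f) seed \<Rightarrow> bool" where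
  "is_seed n emb S \<longleftrightarrow>
     (case S of (x, y, B) \<Rightarrow> free_generating_set n (zp_fractions emb) x \<and> quiver n B)"

definition same_seed :: "nat \<Rightarrow> ('p, 'f) seed \<Rightarrow> ('p, 'f) seed \<Rightarrow> bool" where
  "same_seed n S S' \<longleftrightarrow>
     (case S of (x, y, B) \<Rightarrow> case S' of (x', y', B') \<Rightarrow>
        (\<forall>i\<in>{1..n}. x i = x' i) \<and> (\<forall>i\<in>{1..n}. y i = y' i) \<and> same_quiver n B B')"

definition seed_mutate ::
    "nat \<Rightarrow> ('p::semifield \<Rightarrow> 'f::field) \<Rightarrow> nat \<Rightarrow> ('p, 'f) seed \<Rightarrow> ('p, 'f) seed" where
  "seed_mutate n emb k S =
     (case S of (x, y, B) \<Rightarrow>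
       (x(k := (emb (y k) * (\<Prod>i\<in>{1..n}. x i ^ nat (max (B i k) 0))
                  + (\<Prod>i\<in>{1..n}. x i ^ nat (max (- B i k) 0)))
               / (emb (y k + 1) * x k)),
        \<lambda>j. if j = k then inverse (y k)
            else y j * y k powi max (B k j) 0 * (y k + 1) powi (- B k j),
        mutate k B))"

definition seed_mutates ::
    "nat \<Rightarrow> ('p::semifield \<Rightarrow> 'f::field) \<Rightarrow> nat list \<Rightarrow> ('p, 'f) seed \<Rightarrow> ('p, 'f) seed" where
  "seed_mutates n emb ks S = fold (seed_mutate n emb) ks S"

(* Repetition of a word: repeat_word k [a, b] = [a, b, ..., a, b] has 2 * k entries. *)
definition repeat_word :: "nat \<Rightarrow> nat list \<Rightarrow> nat list" where
  "repeat_word k w = concat (replicate k w)"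

(* n;  1,2,...,1,2;  n-1,...,2,1;  2,1,...,2,1. *)
definition special_sequence :: "nat \<Rightarrow> nat \<Rightarrow> nat list" where
  "special_sequence n k = [n] @ repeat_word k [1, 2] @ rev [1..<n] @ repeat_word k [2, 1]"

end

theory Submission
  imports Defs "HOL-Computational_Algebra.Primes" "HOL-Library.Infinite_Set"
begin

text \<open>
  Give the initial cluster variables distinct primes as multiplicative weights. Since the weights are
  multiplicatively independent, the degree of a monomial determines it, and the two monomials of an
  exchange relation never have the same degree; so no cancellation occurs, whatever the
  coefficients. If all weights are at least \<open>2\<close>, mutation at \<open>k\<close> gives
  \<open>D\<^sub>k' D\<^sub>k \<ge> D\<^sub>j\<^sup>2\<close> for all \<open>j \<noteq> k\<close>. Choosing \<open>j\<close> as the vertex mutated last, whose degree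
  is strictly maximal, yields \<open>D\<^sub>k' > D\<^sub>j\<close>: the maximal degree grows at every step, and the initial
  cluster does not recur.

  In the special cycle, the entries of rows \<open>1\<close> and \<open>2\<close> are, up to sign, terms of sequences satisfying
  \<open>c\<^sub>m\<^sub>+\<^sub>2 = a c\<^sub>m\<^sub>+\<^sub>1 - c\<^sub>m\<close> with \<open>a = b\<^sub>1\<^sub>2 \<ge> 2\<close>; these do not decrease and stay at least \<open>2\<close> from index \<open>1\<close> on,
  so the weights remain large.
\<close>

section \<open>Degrees of rational functions\<close>

lemma zp_embed_superset:
  assumes "finite A" "Poly_Mapping.keys a \<subseteq> A"
  shows "zp_embed emb a = (\<Sum>p\<in>A. of_int (Poly_Mapping.lookup a p) * emb p)"
  unfolding zp_embed_def using assms
  by (intro sum.mono_neutral_left) (auto simp: in_keys_iff)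

lemma zp_embed_zero: "zp_embed emb 0 = 0"
  by (simp add: zp_embed_def)

lemma zp_embed_add: "zp_embed emb (a + b) = zp_embed emb a + zp_embed emb b"
proof -
  let ?A = "Poly_Mapping.keys a \<union> Poly_Mapping.keys b"
  have "Poly_Mapping.keys (a + b) \<subseteq> ?A" by (rule Poly_Mapping.keys_add)
  then show ?thesis
    by (simp add: zp_embed_superset[of ?A] lookup_add algebra_simps sum.distrib)
qed

lemma zp_embed_single: "zp_embed emb (Poly_Mapping.single p c) = of_int c * emb p"
  by (simp add: zp_embed_def)

lemma zp_embed_range_add:
  "u \<in> range (zp_embed emb) \<Longrightarrow> v \<in> range (zp_embed emb) \<Longrightarrow> u + v \<in> range (zp_embed emb)"
  by (auto simp flip: zp_embed_add)

lemma zp_embed_range_sum: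
  assumes "\<And>i. i \<in> A \<Longrightarrow> f i \<in> range (zp_embed emb)"
  shows "sum f A \<in> range (zp_embed emb)"
  using assms
proof (induction A rule: infinite_finite_induct)
  case (insert a A)
  then show ?case by (simp add: zp_embed_range_add)
qed (metis zp_embed_zero rangeI sum.infinite sum.empty)+

lemma zp_embed_range_single: "of_int c * emb p \<in> range (zp_embed emb)"
  by (metis zp_embed_single rangeI)

text \<open>Expanding both sums leaves integer multiples of values \<open>emb (p * q)\<close>.
  Working with the range alone avoids the convolution product of Z[P].\<close>

lemma zp_embed_range_mult:
  assumes "\<And>p q. emb (p * q) = emb p * emb q"
    and "u \<in> range (zp_embed emb)" "v \<in> range (zp_embed emb)"
  shows "u * v \<in> range (zp_embed emb)"
proof -
  obtain a b where u: "u = zp_embed emb a" and v: "v = zp_embed emb b" using assms by blast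
  have "of_int s * emb p * (of_int t * emb q) \<in> range (zp_embed emb)" for s t p q
    using zp_embed_range_single[of "s * t" emb "p * q"] by (simp add: assms(1) mult_ac)
  then show ?thesis
    unfolding u v zp_embed_def[of emb a] zp_embed_def[of emb b] sum_product
    by (intro zp_embed_range_sum)
qed

lemma zp_embed_range_subset_fractions:
  fixes emb :: "'p::one \<Rightarrow> 'f::field"
  assumes "emb 1 = 1"
  shows "range (zp_embed emb) \<subseteq> zp_fractions emb"
proof
  fix u assume "u \<in> range (zp_embed emb)"
  then obtain a where "u = zp_embed emb a" by blast
  then have "u = zp_embed emb a / zp_embed emb (Poly_Mapping.single 1 1)"
    by (simp add: zp_embed_single assms)
  moreover have "Poly_Mapping.single (1::'p) (1::int) \<noteq> 0"
    by (metis lookup_single_eq lookup_zero zero_neq_one)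
  ultimately show "u \<in> zp_fractions emb" unfolding zp_fractions_def
    by (intro CollectI exI conjI)
qed

section \<open>Values of polynomials\<close>

lemma poly_value_superset:
  assumes "finite A" "Poly_Mapping.keys p \<subseteq> A"
  shows "poly_value p x = (\<Sum>m\<in>A. Poly_Mapping.lookup p m *
    (\<Prod>i\<in>Poly_Mapping.keys m. x i ^ Poly_Mapping.lookup m i))"
  unfolding poly_value_def using assms
  by (intro sum.mono_neutral_left) (auto simp: in_keys_iff)

lemma poly_value_add: "poly_value (p + q) x = poly_value p x + poly_value q x"
proof -
  let ?A = "Poly_Mapping.keys p \<union> Poly_Mapping.keys q"
  have "Poly_Mapping.keys (p + q) \<subseteq> ?A" by (rule Poly_Mapping.keys_add)
  then show ?thesis
    by (simp add: poly_value_superset[of ?A] lookup_add algebra_simps sum.distrib)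
qed

lemma poly_value_single:
  "poly_value (Poly_Mapping.single m c) x =
    c * (\<Prod>i\<in>Poly_Mapping.keys m. x i ^ Poly_Mapping.lookup m i)"
  by (simp add: poly_value_def)

lemma algebraically_independent_mono:
  "algebraically_independent n K x \<Longrightarrow> L \<subseteq> K \<Longrightarrow> algebraically_independent n L x"
  unfolding algebraically_independent_def polynomials_def by blast

lemma prod_power_indicator:
  fixes h :: "'i \<Rightarrow> 'a::comm_monoid_mult"
  assumes "finite A" "i \<in> A"
  shows "(\<Prod>j\<in>A. h j ^ (if j = i then 1 else 0)) = h i"
proof -
  have "(\<Prod>j\<in>A. h j ^ (if j = i then 1 else 0)) = (\<Prod>j\<in>A. if j = i then h j else 1)"
    by (intro prod.cong) auto
  then show ?thesis using assms by simp
qed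

text \<open>The axioms make \<open>K\<close> a subring; it will be the image of Z[P], where all
  coefficients of exchange relations lie. Degrees are written multiplicatively, as products of
  weights, so that prime weights become possible and an exchange quotient gets the quotient of
  degrees.\<close>

locale monomial_valuation =
  fixes n :: nat and K :: "'f::field set" and z :: "nat \<Rightarrow> 'f" and w :: "nat \<Rightarrow> real"
  assumes neg_one_in: "- 1 \<in> K"
    and add_in: "a \<in> K \<Longrightarrow> b \<in> K \<Longrightarrow> a + b \<in> K"
    and mult_in: "a \<in> K \<Longrightarrow> b \<in> K \<Longrightarrow> a * b \<in> K"
    and indep: "algebraically_independent n K z"
    and weight_pos: "i \<in> {1..n} \<Longrightarrow> w i > 0"
begin

definition mon :: "(nat \<Rightarrow> nat) \<Rightarrow> 'f" where
  "mon e = (\<Prod>i\<in>{1..n}. z i ^ e i)"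

definition mdeg :: "(nat \<Rightarrow> nat) \<Rightarrow> real" where
  "mdeg e = (\<Prod>i\<in>{1..n}. w i ^ e i)"

lemma mon_add: "mon (\<lambda>i. e i + e' i) = mon e * mon e'"
  by (simp add: mon_def power_add prod.distrib)

lemma mdeg_add: "mdeg (\<lambda>i. e i + e' i) = mdeg e * mdeg e'"
  by (simp add: mdeg_def power_add prod.distrib)

lemma mdeg_pos: "mdeg e > 0"
  unfolding mdeg_def by (intro prod_pos zero_less_power weight_pos) auto

lemma one_in: "1 \<in> K"
  using mult_in[OF neg_one_in neg_one_in] by simp

text \<open>These are the \<open>K\<close>-combinations of monomials of degree less than
  \<open>d\<close>. Generating them term by term gives closure under sums and products by rule
  induction; the passage to formal polynomials happens only once, in
  \<open>below_poly\<close>.\<close>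

inductive_set below :: "real \<Rightarrow> 'f set" for d :: real where
  below_zero: "0 \<in> below d"
| below_step: "r \<in> below d \<Longrightarrow> c \<in> K \<Longrightarrow> mdeg e < d \<Longrightarrow> r + c * mon e \<in> below d"

lemma below_mono: "r \<in> below d \<Longrightarrow> d \<le> d' \<Longrightarrow> r \<in> below d'"
  by (induction rule: below.induct) (auto intro: below_zero below_step)

lemma below_add: "s \<in> below d \<Longrightarrow> r \<in> below d \<Longrightarrow> r + s \<in> below d"
  by (induction rule: below.induct) (auto simp flip: add.assoc intro: below_step)

lemma below_mon_mult: "r \<in> below d \<Longrightarrow> a \<in> K \<Longrightarrow> a * mon u * r \<in> below (mdeg u * d)"
proof (induction rule: below.induct)
  case (below_step r c e)
  have "a * mon u * r + (a * c) * mon (\<lambda>i. u i + e i) \<in> below (mdeg u * d)"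
    using below_step by (intro below.below_step) (auto simp: mult_in mdeg_add mdeg_pos)
  then show ?case by (simp add: mon_add algebra_simps)
qed (simp add: below_zero)

lemma below_mult:
  assumes "r \<in> below d" "s \<in> below d'" "d' \<ge> 0"
  shows "r * s \<in> below (d * d')"
  using assms(1)
proof (induction rule: below.induct)
  case (below_step r c e)
  have "c * mon e * s \<in> below (mdeg e * d')" using assms below_step below_mon_mult by blast
  then have "c * mon e * s \<in> below (d * d')"
    by (rule below_mono) (use below_step assms in \<open>simp add: mult_right_mono\<close>)
  from below_add[OF this below_step.IH] show ?case by (simp add: algebra_simps)
qed (simp add: below_zero)

text \<open>A single monomial carries the top degree and the rest lies strictly below. Leading terms
  therefore multiply without ties, for any positive weights.\<close>

definition lead :: "'f \<Rightarrow> real \<Rightarrow> bool" where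
  "lead f d \<longleftrightarrow> (\<exists>c e. c \<in> K \<and> c \<noteq> 0 \<and> d = mdeg e \<and> f - c * mon e \<in> below d)"

lemma lead_pos: "lead f d \<Longrightarrow> d > 0"
  using mdeg_pos unfolding lead_def by auto

lemma lead_const: "c \<in> K \<Longrightarrow> c \<noteq> 0 \<Longrightarrow> lead c 1"
  unfolding lead_def
  by (intro exI[of _ c] exI[of _ "\<lambda>_. 0"]) (auto simp: mdeg_def mon_def below_zero)

lemma lead_gen: assumes "i \<in> {1..n}" shows "lead (z i) (w i)"
  unfolding lead_def mon_def mdeg_def
    by (intro exI[of _ 1] exI[of _ "\<lambda>j. if j = i then 1 else 0"])
       (use assms in \<open>auto simp: prod_power_indicator one_in below_zero simp del: One_nat_def\<close>)

lemma lead_mult: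
  assumes "lead f d" "lead g d'"
  shows "lead (f * g) (d * d')"
proof -
  obtain c e where f: "c \<in> K" "c \<noteq> 0" "d = mdeg e" "f - c * mon e \<in> below d"
    using assms unfolding lead_def by blast
  obtain c' e' where g: "c' \<in> K" "c' \<noteq> 0" "d' = mdeg e'" "g - c' * mon e' \<in> below d'"
    using assms unfolding lead_def by blast
  let ?r = "f - c * mon e" and ?s = "g - c' * mon e'"
  have "c * mon e * ?s \<in> below (d * d')" "c' * mon e' * ?r \<in> below (d' * d)"
    using f g below_mon_mult by auto
  moreover have "?r * ?s \<in> below (d * d')"
    using f g mdeg_pos[of e'] by (intro below_mult) auto
  ultimately have "?r * ?s + (c * mon e * ?s + c' * mon e' * ?r) \<in> below (d * d')"
    by (intro below_add) (simp_all add: mult.commute)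
  moreover have "?r * ?s + (c * mon e * ?s + c' * mon e' * ?r) =
      f * g - (c * c') * mon (\<lambda>i. e i + e' i)"
    by (simp add: mon_add algebra_simps)
  ultimately show ?thesis
    unfolding lead_def using f g
    by (intro exI[of _ "c * c'"] exI[of _ "\<lambda>i. e i + e' i"]) (auto simp: mult_in mdeg_add)
qed

lemma lead_below: "lead f d \<Longrightarrow> d < d' \<Longrightarrow> f \<in> below d'"
proof -
  assume "lead f d" "d < d'"
  then obtain c e where f: "c \<in> K" "d = mdeg e" "f - c * mon e \<in> below d"
    unfolding lead_def by blast
  have "f - c * mon e + c * mon e \<in> below d'"
    using f \<open>d < d'\<close> by (intro below_step) (auto intro: below_mono)
  then show ?thesis by simp
qed

lemma lead_add:
  assumes "lead f d" "lead g d'" "d' < d"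
  shows "lead (f + g) d"
proof -
  obtain c e where f: "c \<in> K" "c \<noteq> 0" "d = mdeg e" "f - c * mon e \<in> below d"
    using assms unfolding lead_def by blast
  have "f - c * mon e + g \<in> below d" using below_add[OF lead_below f(4)] assms by blast
  then show ?thesis unfolding lead_def using f
    by (intro exI[of _ c] exI[of _ e]) (auto simp: algebra_simps)
qed

text \<open>Exponents in \<open>mon\<close> and \<open>mdeg\<close> are arbitrary functions whose
  values outside \<open>{1..n}\<close> have no effect. Truncating them to that range gives the
  finitely supported exponents that formal polynomials require.\<close>

lemma exponent_vector:
  obtains m :: "nat \<Rightarrow>\<^sub>0 nat" where "Poly_Mapping.keys m \<subseteq> {1..n}"
    "mdeg (Poly_Mapping.lookup m) = mdeg e"
    "(\<Prod>i\<in>Poly_Mapping.keys m. z i ^ Poly_Mapping.lookup m i) = mon e"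
proof -
  define m where "m = Abs_poly_mapping (\<lambda>i. if i \<in> {1..n} then e i else 0)"
  have l: "Poly_Mapping.lookup m = (\<lambda>i. if i \<in> {1..n} then e i else 0)"
    unfolding m_def by (rule lookup_Abs_poly_mapping) (rule finite_subset[of _ "{1..n}"], auto)
  have k: "Poly_Mapping.keys m \<subseteq> {1..n}" by (auto simp: in_keys_iff l split: if_splits)
  have "(\<Prod>i\<in>Poly_Mapping.keys m. z i ^ Poly_Mapping.lookup m i) =
      (\<Prod>i\<in>{1..n}. z i ^ Poly_Mapping.lookup m i)"
    using k by (intro prod.mono_neutral_left) (auto simp: in_keys_iff)
  with k show ?thesis
    by (intro that[of m]) (auto simp: mdeg_def mon_def l intro!: prod.cong)
qed

lemma below_poly:
  assumes "r \<in> below d"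
  shows "\<exists>p\<in>polynomials n K. poly_value p z = r \<and>
    (\<forall>m\<in>Poly_Mapping.keys p. mdeg (Poly_Mapping.lookup m) < d)"
  using assms
proof (induction rule: below.induct)
  case below_zero
  show ?case by (intro bexI[of _ 0]) (auto simp: poly_value_def polynomials_def)
next
  case (below_step r c e)
  then obtain p where p: "p \<in> polynomials n K" "poly_value p z = r"
      "\<forall>m\<in>Poly_Mapping.keys p. mdeg (Poly_Mapping.lookup m) < d" by blast
  obtain m :: "nat \<Rightarrow>\<^sub>0 nat" where m: "Poly_Mapping.keys m \<subseteq> {1..n}" "mdeg (Poly_Mapping.lookup m) = mdeg e"
    "(\<Prod>i\<in>Poly_Mapping.keys m. z i ^ Poly_Mapping.lookup m i) = mon e"
    by (rule exponent_vector)
  let ?q = "p + Poly_Mapping.single m c"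
  have keys: "Poly_Mapping.keys ?q \<subseteq> insert m (Poly_Mapping.keys p)"
    using Poly_Mapping.keys_add[of p "Poly_Mapping.single m c"] by (auto split: if_splits)
  have "Poly_Mapping.lookup ?q m' \<in> K" if "m' \<in> Poly_Mapping.keys ?q" for m'
    using that keys p(1) below_step(2)
    unfolding polynomials_def
    by (cases "m' \<in> Poly_Mapping.keys p")
       (auto simp: lookup_add lookup_single when_def add_in in_keys_iff)
  then have "?q \<in> polynomials n K"
    using keys p(1) m(1) unfolding polynomials_def by blast
  moreover have "poly_value ?q z = r + c * mon e"
    by (simp add: poly_value_add poly_value_single p(2) m(3))
  ultimately show ?case
    using keys p(3) m(2) below_step(3) by (intro bexI[of _ ?q]) auto
qed

text \<open>Algebraic independence enters here. In a polynomial representing \<open>f\<close>, the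
  leading exponent differs from all others because its degree is strictly larger, so its coefficient
  \<open>c\<close> survives and the polynomial cannot vanish.\<close>

lemma lead_nonzero:
  assumes "lead f d"
  shows "f \<noteq> 0"
proof
  assume "f = 0"
  obtain c e where f: "c \<in> K" "c \<noteq> 0" "d = mdeg e" "f - c * mon e \<in> below d"
    using assms unfolding lead_def by blast
  obtain p where p: "p \<in> polynomials n K" "poly_value p z = f - c * mon e"
      "\<forall>m\<in>Poly_Mapping.keys p. mdeg (Poly_Mapping.lookup m) < d"
    using below_poly f by blast
  obtain m :: "nat \<Rightarrow>\<^sub>0 nat" where m: "Poly_Mapping.keys m \<subseteq> {1..n}" "mdeg (Poly_Mapping.lookup m) = mdeg e"
    "(\<Prod>i\<in>Poly_Mapping.keys m. z i ^ Poly_Mapping.lookup m i) = mon e"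
    by (rule exponent_vector)
  let ?q = "p + Poly_Mapping.single m c"
  have m_notin: "m \<notin> Poly_Mapping.keys p" using p(3) m(2) f(3) by auto
  have keys: "Poly_Mapping.keys ?q \<subseteq> insert m (Poly_Mapping.keys p)"
    using Poly_Mapping.keys_add[of p "Poly_Mapping.single m c"] by (auto split: if_splits)
  have lk: "Poly_Mapping.lookup ?q m' \<in> K" if "m' \<in> Poly_Mapping.keys ?q" for m'
    using that keys p(1) f(1)
    unfolding polynomials_def
    by (cases "m' \<in> Poly_Mapping.keys p")
       (auto simp: lookup_add lookup_single when_def add_in in_keys_iff)
  then have "?q \<in> polynomials n K"
    using keys p(1) m(1) unfolding polynomials_def by blast
  moreover have "poly_value ?q z = 0"
    by (simp add: poly_value_add poly_value_single p(2) m(3) \<open>f = 0\<close>)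
  ultimately have "?q = 0" using indep unfolding algebraically_independent_def by blast
  then have "Poly_Mapping.lookup ?q m = 0" by simp
  with m_notin f(2) show False by (simp add: lookup_add in_keys_iff)
qed

section \<open>Degrees of quotients\<close>

definition val :: "'f \<Rightarrow> real \<Rightarrow> bool" where
  "val f v \<longleftrightarrow> (\<exists>a b d e. lead a d \<and> lead b e \<and> f = a / b \<and> v = d / e)"

lemma lead_val: "lead f d \<Longrightarrow> val f d"
  unfolding val_def using lead_const[OF one_in]
  by (intro exI[of _ f] exI[of _ 1] exI[of _ d]) auto

lemma val_mult: "val f v \<Longrightarrow> val g u \<Longrightarrow> val (f * g) (v * u)"
  unfolding val_def
proof clarify
  fix a b d e a' b' d' e'
  assume "lead a d" "lead b e" "lead a' d'" "lead b' e'"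
  then show "\<exists>s t i j. lead s i \<and> lead t j \<and> a / b * (a' / b') = s / t \<and> d / e * (d' / e') = i / j"
    by (intro exI[of _ "a * a'"] exI[of _ "b * b'"] exI[of _ "d * d'"] exI[of _ "e * e'"])
       (simp add: lead_mult)
qed

lemma val_inverse: "val f v \<Longrightarrow> val (inverse f) (inverse v)"
  unfolding val_def by (metis inverse_divide)

lemma val_divide: "val f v \<Longrightarrow> val g u \<Longrightarrow> val (f / g) (v / u)"
  by (simp add: divide_inverse val_mult val_inverse)

lemma val_const: "c \<in> K \<Longrightarrow> c \<noteq> 0 \<Longrightarrow> val c 1"
  by (intro lead_val lead_const)

lemma val_power: "val f v \<Longrightarrow> val (f ^ m) (v ^ m)"
  by (induction m) (auto intro: val_mult val_const one_in)

lemma val_prod: "(\<And>i. i \<in> A \<Longrightarrow> val (f i) (v i)) \<Longrightarrow> val (prod f A) (prod v A)"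
  by (induction A rule: infinite_finite_induct) (auto intro: val_mult val_const one_in)

text \<open>Over the common denominator \<open>b * b'\<close>, the hypothesis \<open>u < v\<close>
  becomes \<open>d' * e < d * e'\<close>, so the first summand of the numerator dominates the
  second.\<close>

lemma val_add:
  assumes "val f v" "val g u" "u < v"
  shows "val (f + g) v"
proof -
  obtain a b d e where f: "lead a d" "lead b e" "f = a / b" "v = d / e"
    using assms unfolding val_def by blast
  obtain a' b' d' e' where g: "lead a' d'" "lead b' e'" "g = a' / b'" "u = d' / e'"
    using assms unfolding val_def by blast
  have pos: "e > 0" "e' > 0" using f g lead_pos by auto
  have nz: "b \<noteq> 0" "b' \<noteq> 0" using f g lead_nonzero by auto
  have "d' * e < d * e'" using assms(3) pos f g by (simp add: field_simps)
  then have "lead (a * b' + a' * b) (d * e')"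
    using f g by (intro lead_add[of _ _ _ "d' * e"] lead_mult)
  moreover have "lead (b * b') (e * e')" using f g lead_mult by auto
  moreover have "f + g = (a * b' + a' * b) / (b * b')" using nz f g by (simp add: field_simps)
  moreover have "v = (d * e') / (e * e')" using pos f by simp
  ultimately show ?thesis
    unfolding val_def
    by (intro exI[of _ "a * b' + a' * b"] exI[of _ "b * b'"] exI[of _ "d * e'"] exI[of _ "e * e'"] conjI)
qed

lemma val_add_max:
  assumes "val f v" "val g u" "u \<noteq> v"
  shows "val (f + g) (max v u)"
proof (cases "u < v")
  case True
  then show ?thesis using val_add[OF assms(1,2)] by (simp add: max_def)
next
  case False
  then have "v < u" using assms(3) by simp
  then show ?thesis using val_add[OF assms(2,1)] by (simp add: max_def add.commute)
qed

lemma val_nonzero: "val f v \<Longrightarrow> f \<noteq> 0"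
  unfolding val_def by (auto dest!: lead_nonzero)

text \<open>If the two values differed, \<open>f + (- f)\<close> would have the larger one as its
  value, but zero has none. Thus \<open>val\<close> is a partial function, independent of the chosen
  fraction.\<close>

lemma val_unique:
  assumes "val f v" "val f u"
  shows "v = u"
proof -
  have "val (- f) t" if "val f t" for t
    using val_mult[OF val_const[OF neg_one_in] that] by simp
  from this[OF assms(2)] have "val (- f) u" .
  with val_add_max[OF assms(1) this] show ?thesis by (auto dest: val_nonzero)
qed

end

section \<open>Growth of degrees under seed mutation\<close>

definition mult_indep :: "nat \<Rightarrow> (nat \<Rightarrow> real) \<Rightarrow> bool" where
  "mult_indep n D \<longleftrightarrow> (\<forall>f g :: nat \<Rightarrow> nat.
     (\<Prod>i\<in>{1..n}. D i ^ f i) = (\<Prod>i\<in>{1..n}. D i ^ g i) \<longrightarrow> (\<forall>i\<in>{1..n}. f i = g i))"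

text \<open>Unique factorization: the exponent of \<open>q j\<close> is its multiplicity in the
  product. Injectivity allows the product to be reindexed by the primes themselves.\<close>

lemma mult_indep_primes:
  assumes "inj_on q {1..n}" "\<And>i. prime (q i :: nat)"
  shows "mult_indep n (\<lambda>i. real (q i))"
  unfolding mult_indep_def
proof (intro allI impI ballI)
  fix f g :: "nat \<Rightarrow> nat" and j
  assume eq: "(\<Prod>i\<in>{1..n}. real (q i) ^ f i) = (\<Prod>i\<in>{1..n}. real (q i) ^ g i)" and j: "j \<in> {1..n}"
  let ?r = "inv_into {1..n} q"
  have mult: "multiplicity (q j) (\<Prod>i\<in>{1..n}. q i ^ h i) = h j" for h :: "nat \<Rightarrow> nat"
  proof -
    have "(\<Prod>i\<in>{1..n}. q i ^ h i) = (\<Prod>p\<in>q ` {1..n}. p ^ h (?r p))"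
      using assms(1) by (simp add: prod.reindex inv_into_f_f)
    also have "multiplicity (q j) \<dots> = h (?r (q j))"
      using assms(2) j by (subst multiplicity_prod_prime_powers) auto
    finally show ?thesis using assms(1) j by (simp add: inv_into_f_f)
  qed
  from eq have "real (\<Prod>i\<in>{1..n}. q i ^ f i) = real (\<Prod>i\<in>{1..n}. q i ^ g i)" by simp
  then have "(\<Prod>i\<in>{1..n}. q i ^ f i) = (\<Prod>i\<in>{1..n}. q i ^ g i)" by (simp only: of_nat_eq_iff)
  then show "f j = g j" using mult[of f] mult[of g] by simp
qed

text \<open>An exchange replaces \<open>D k\<close> by a monomial in the other degrees divided by
  \<open>D k\<close>. This change of exponents is invertible over the integers, so independence
  persists through mutation.\<close>

lemma mult_indep_update:
  assumes ind: "mult_indep n D" and pos: "\<And>i. i \<in> {1..n} \<Longrightarrow> D i > 0"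
    and k: "k \<in> {1..n}" and ck: "c k = (0::nat)"
  shows "mult_indep n (D(k := (\<Prod>i\<in>{1..n}. D i ^ c i) / D k))"
proof -
  define d where "d = (\<Prod>i\<in>{1..n}. D i ^ c i) / D k"
  have Dk: "D k > 0" using pos k .
  have remove: "(\<Prod>i\<in>{1..n}. t i) = t k * (\<Prod>i\<in>{1..n} - {k}. t i)" for t :: "nat \<Rightarrow> real"
    using k by (intro prod.remove) auto
  \<comment> \<open>Multiplying by \<open>D k ^ f k\<close> clears the denominators. The extra power
    \<open>s\<close> is left free so that both sides of a relation can be multiplied by the same
    quantity.\<close>
  have clear: "(\<Prod>i\<in>{1..n}. (D(k := d)) i ^ f i) * D k ^ f k * D k ^ s =
      (\<Prod>i\<in>{1..n}. D i ^ (if i = k then s else f i + c i * f k))" for f s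
  proof -
    have "d ^ f k * D k ^ f k = (\<Prod>i\<in>{1..n}. D i ^ c i) ^ f k"
      using Dk by (simp add: d_def power_divide)
    also have "\<dots> = (\<Prod>i\<in>{1..n} - {k}. D i ^ (c i * f k))"
      unfolding remove by (simp add: ck power_mult flip: prod_power_distrib)
    finally have *: "d ^ f k * D k ^ f k = (\<Prod>i\<in>{1..n} - {k}. D i ^ (c i * f k))" .
    have "(\<Prod>i\<in>{1..n}. (D(k := d)) i ^ f i) = d ^ f k * (\<Prod>i\<in>{1..n} - {k}. D i ^ f i)"
      unfolding remove by (intro arg_cong2[where f = "(*)"] prod.cong) auto
    then have "(\<Prod>i\<in>{1..n}. (D(k := d)) i ^ f i) * D k ^ f k * D k ^ s =
       D k ^ s * ((\<Prod>i\<in>{1..n} - {k}. D i ^ f i) * (d ^ f k * D k ^ f k))" by (simp add: mult_ac)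
    also have "\<dots> = D k ^ s * (\<Prod>i\<in>{1..n} - {k}. D i ^ (f i + c i * f k))"
      unfolding * by (simp add: power_add prod.distrib)
    also have "\<dots> = (\<Prod>i\<in>{1..n}. D i ^ (if i = k then s else f i + c i * f k))"
      unfolding remove[of "\<lambda>i. D i ^ (if i = k then s else f i + c i * f k)"]
      by (intro arg_cong2[where f = "(*)"] prod.cong) auto
    finally show ?thesis .
  qed
  have "mult_indep n (D(k := d))"
    unfolding mult_indep_def
  proof (intro allI impI ballI)
    fix f g :: "nat \<Rightarrow> nat" and j
    assume eq: "(\<Prod>i\<in>{1..n}. (D(k := d)) i ^ f i) = (\<Prod>i\<in>{1..n}. (D(k := d)) i ^ g i)"
      and j: "j \<in> {1..n}"
    \<comment> \<open>With \<open>s = g k\<close> on one side and \<open>s = f k\<close> on the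
      other, both sides acquire the factor \<open>D k ^ (f k + g k)\<close>. Comparing exponents at
      \<open>k\<close> gives \<open>f k = g k\<close>, and then the terms \<open>c i * f k\<close>
      cancel elsewhere.\<close>
    have clear_eq: "(\<Prod>i\<in>{1..n}. D i ^ (if i = k then g k else f i + c i * f k)) =
        (\<Prod>i\<in>{1..n}. D i ^ (if i = k then f k else g i + c i * g k))"
      unfolding clear[symmetric] eq by (simp add: mult_ac)
    have *: "(if i = k then g k else f i + c i * f k) = (if i = k then f k else g i + c i * g k)"
      if "i \<in> {1..n}" for i
      by (rule ind[unfolded mult_indep_def, rule_format, OF clear_eq that])
    show "f j = g j" using *[OF j] *[OF k] by (auto split: if_splits)
  qed
  then show ?thesis by (simp add: d_def)
qed

text \<open>Independence separates the two monomials because \<open>b j\<close> is nonzero. As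
  \<open>b j\<close> has absolute value at least 2, one of them contains the square of
  \<open>D j\<close>, and all other factors are at least 1; dividing by \<open>D k < D j\<close>
  leaves more than \<open>D j\<close>.\<close>

lemma degree_growth:
  fixes D :: "nat \<Rightarrow> real" and b :: "nat \<Rightarrow> int" and n :: nat
  defines "P \<equiv> \<Prod>i\<in>{1..n}. D i ^ nat (max (b i) 0)"
    and "N \<equiv> \<Prod>i\<in>{1..n}. D i ^ nat (max (- b i) 0)"
  assumes jk: "j \<in> {1..n}" "k \<in> {1..n}" "j \<noteq> k"
    and b: "b k = 0" "\<And>i. i \<in> {1..n} - {k} \<Longrightarrow> \<bar>b i\<bar> \<ge> 2"
    and D: "\<And>i. i \<in> {1..n} \<Longrightarrow> D i \<ge> 1" "D k < D j" and ind: "mult_indep n D"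
  shows "P \<noteq> N" "D j < max P N / D k" "mult_indep n (D(k := max P N / D k))"
proof -
  have bj: "\<bar>b j\<bar> \<ge> 2" using b(2) jk by simp
  show "P \<noteq> N"
  proof
    assume "P = N"
    then have "nat (max (b j) 0) = nat (max (- b j) 0)"
      using ind[unfolded mult_indep_def, rule_format, of "\<lambda>i. nat (max (b i) 0)"
          "\<lambda>i. nat (max (- b i) 0)" j] jk(1) unfolding P_def N_def by blast
    then show False using bj by (auto simp: max_def split: if_splits)
  qed
  have large: "(\<Prod>i\<in>{1..n}. D i ^ nat (max (s i) 0)) \<ge> (D j)\<^sup>2" if "s j \<ge> 2" for s :: "nat \<Rightarrow> int"
  proof -
    have "(D j)\<^sup>2 \<le> D j ^ nat (max (s j) 0)"
      using that D(1)[OF jk(1)] by (intro power_increasing) auto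
    also have "\<dots> \<le> D j ^ nat (max (s j) 0) * (\<Prod>i\<in>{1..n} - {j}. D i ^ nat (max (s i) 0))"
    proof -
      have "1 \<le> (\<Prod>i\<in>{1..n} - {j}. D i ^ nat (max (s i) 0))"
        by (intro prod_ge_1 one_le_power D(1)) auto
      from mult_left_mono[OF this, of "D j ^ nat (max (s j) 0)"] D(1)[OF jk(1)]
      show ?thesis by simp
    qed
    also have "\<dots> = (\<Prod>i\<in>{1..n}. D i ^ nat (max (s i) 0))"
      using jk by (intro prod.remove[symmetric]) auto
    finally show ?thesis .
  qed
  have "(D j)\<^sup>2 \<le> max P N"
  proof (cases "b j \<ge> 2")
    case True
    from large[of b, OF this] show ?thesis unfolding P_def by simp
  next
    case False
    then have "- b j \<ge> 2" using bj by linarith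
    from large[of "\<lambda>i. - b i", OF this] show ?thesis unfolding N_def by simp
  qed
  moreover have "D j * D k < (D j)\<^sup>2"
    using D(1)[OF jk(1)] D(2) by (simp add: power2_eq_square)
  ultimately show "D j < max P N / D k"
    using D(1)[OF jk(2)] by (simp add: field_simps)
  have pos: "D i > 0" if "i \<in> {1..n}" for i using D(1)[OF that] by simp
  show "mult_indep n (D(k := max P N / D k))"
  proof (cases "P \<le> N")
    case True
    then show ?thesis
      using mult_indep_update[OF ind pos jk(2), of "\<lambda>i. nat (max (- b i) 0)"] b(1)
      by (simp add: max_def N_def)
  next
    case False
    then show ?thesis
      using mult_indep_update[OF ind pos jk(2), of "\<lambda>i. nat (max (b i) 0)"] b(1)
      by (simp add: max_def P_def)
  qed
qed

section \<open>Matrix mutation and words of mutations\<close>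

lemma half_abs_product:
  fixes x y :: int
  shows "(\<bar>x\<bar> * y + x * \<bar>y\<bar>) div 2 =
    (if 0 \<le> x \<and> 0 \<le> y then x * y else if x \<le> 0 \<and> y \<le> 0 then - (x * y) else 0)"
  by (auto simp: abs_if)

text \<open>The two middle cases are paths through \<open>k\<close> in either direction. Their
  inequalities are weak because a zero entry contributes a zero product, so sign information alone
  selects a correct case.\<close>

lemma mutate_eq:
  "mutate k B i j = (if i = k \<or> j = k then - B i j
     else if 0 \<le> B i k \<and> 0 \<le> B k j then B i j + B i k * B k j
     else if B i k \<le> 0 \<and> B k j \<le> 0 then B i j - B i k * B k j else B i j)"
  unfolding mutate_def half_abs_product by auto

lemma quiver_mutate:
  assumes "quiver n B" "k \<in> {1..n}"
  shows "quiver n (mutate k B)"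
  unfolding quiver_def
proof (intro ballI)
  fix i j assume ij: "i \<in> {1..n}" "j \<in> {1..n}"
  have "B i j = - B j i" "B i k = - B k i" "B k j = - B j k"
    using assms ij unfolding quiver_def by blast+
  then show "mutate k B i j = - mutate k B j i" by (auto simp: mutate_eq)
qed

lemma mutates_Nil [simp]: "mutates [] B = B"
  by (simp add: mutates_def)

lemma mutates_Cons [simp]: "mutates (k # ks) B = mutates ks (mutate k B)"
  by (simp add: mutates_def)

lemma mutates_append: "mutates (ks @ ls) B = mutates ls (mutates ks B)"
  by (simp add: mutates_def)

lemma large_weights_along_Nil: "large_weights_along n B [] \<longleftrightarrow> large_weights n B"
  by (simp add: large_weights_along_def)

lemma large_weights_along_Cons:
  "large_weights_along n B (k # ks) \<longleftrightarrow>
     large_weights n B \<and> large_weights_along n (mutate k B) ks"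
proof -
  have "(\<forall>m\<le>Suc l. P m) \<longleftrightarrow> P 0 \<and> (\<forall>m\<le>l. P (Suc m))" for P and l :: nat
    by (metis Suc_le_mono le0 not0_implies_Suc)
  then show ?thesis by (simp add: large_weights_along_def)
qed

section \<open>Clusters with a dominant variable\<close>

context monomial_valuation
begin

text \<open>This is the invariant of the growth argument. Here \<open>j\<close> is the vertex
  mutated last or, at the start, a vertex chosen to have the largest weight.\<close>

definition dominated :: "(nat \<Rightarrow> 'f) \<Rightarrow> (nat \<Rightarrow> real) \<Rightarrow> nat \<Rightarrow> bool" where
  "dominated x D j \<longleftrightarrow> j \<in> {1..n} \<and> (\<forall>i\<in>{1..n}. val (x i) (D i) \<and> 1 \<le> D i) \<and>
     mult_indep n D \<and> (\<forall>i\<in>{1..n} - {j}. D i < D j)"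

text \<open>Coefficients are nonzero elements of \<open>K\<close> and have value 1, so the exchange
  relation takes the degrees \<open>P\<close> and \<open>N\<close> of its two monomials. These
  differ, hence nothing cancels, and \<open>degree_growth\<close> makes \<open>k\<close> the new
  dominant vertex.\<close>

lemma dominated_seed_mutate:
  fixes emb :: "'p::semifield \<Rightarrow> 'f"
  assumes dom: "dominated x D j" and k: "k \<in> {1..n}" "k \<noteq> j"
    and B: "quiver n B" "large_weights n B" and emb: "\<And>p. emb p \<in> K \<and> emb p \<noteq> 0"
  shows "\<exists>x' y' D'. seed_mutate n emb k (x, y, B) = (x', y', mutate k B) \<and>
    dominated x' D' k \<and> D j < D' k"
proof -
  define P N where "P = (\<Prod>i\<in>{1..n}. D i ^ nat (max (B i k) 0))"
    and "N = (\<Prod>i\<in>{1..n}. D i ^ nat (max (- B i k) 0))"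
  define D' where "D' = D(k := max P N / D k)"
  obtain x' y' where S: "seed_mutate n emb k (x, y, B) = (x', y', mutate k B)"
    and x': "x' = x(k := (emb (y k) * (\<Prod>i\<in>{1..n}. x i ^ nat (max (B i k) 0))
                  + (\<Prod>i\<in>{1..n}. x i ^ nat (max (- B i k) 0))) / (emb (y k + 1) * x k))"
    unfolding seed_mutate_def by simp
  have j: "j \<in> {1..n}" and xD: "val (x i) (D i)" and D1: "1 \<le> D i" if "i \<in> {1..n}" for i
    using dom that unfolding dominated_def by auto
  have Dj: "D i < D j" if "i \<in> {1..n} - {j}" for i
    using dom that unfolding dominated_def by auto
  have ind: "mult_indep n D" using dom unfolding dominated_def by simp
  have "B k k = - B k k" using B(1) k(1) unfolding quiver_def by blast
  then have b: "B k k = 0" "\<And>i. i \<in> {1..n} - {k} \<Longrightarrow> \<bar>B i k\<bar> \<ge> 2"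
    using B(2) k(1) unfolding large_weights_def by auto
  have DkDj: "D k < D j" using k Dj by simp
  note growth = degree_growth[where n = n and D = D and b = "\<lambda>i. B i k", OF j[OF k(1)] k(1) k(2)[symmetric] b D1 DkDj ind, folded P_def N_def]
  have "val (emb (y k) * (\<Prod>i\<in>{1..n}. x i ^ nat (max (B i k) 0)) +
      (\<Prod>i\<in>{1..n}. x i ^ nat (max (- B i k) 0))) (max P N)"
  proof (rule val_add_max)
    have "val (emb (y k) * (\<Prod>i\<in>{1..n}. x i ^ nat (max (B i k) 0))) (1 * P)"
      unfolding P_def by (intro val_mult val_const val_prod val_power xD) (auto simp: emb)
    then show "val (emb (y k) * (\<Prod>i\<in>{1..n}. x i ^ nat (max (B i k) 0))) P" by simp
    show "val (\<Prod>i\<in>{1..n}. x i ^ nat (max (- B i k) 0)) N"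
      unfolding N_def by (intro val_prod val_power xD)
  qed (use growth in simp)
  moreover have "val (emb (y k + 1) * x k) (1 * D k)"
    by (intro val_mult val_const xD k) (auto simp: emb)
  ultimately have "val (x' k) (D' k)"
    unfolding x' D'_def using val_divide by fastforce
  then have "val (x' i) (D' i)" if "i \<in> {1..n}" for i
    using xD that unfolding x' D'_def by (cases "i = k") auto
  moreover have lt: "D j < D' k" using growth by (simp add: D'_def)
  moreover have "D' i < D' k" if "i \<in> {1..n} - {k}" for i
  proof -
    have "D' i = D i" using that by (simp add: D'_def)
    moreover have "D i \<le> D j" using Dj[of i] that by (cases "i = j") auto
    ultimately show ?thesis using lt by simp
  qed
  moreover have "1 \<le> D' i" if "i \<in> {1..n}" for i
  proof (cases "i = k")
    case True
    then show ?thesis using D1[OF j[OF that]] lt by simp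
  next
    case False
    then show ?thesis using D1[OF that] by (simp add: D'_def)
  qed
  moreover have "mult_indep n D'" unfolding D'_def using growth by simp
  ultimately have "dominated x' D' k" unfolding dominated_def using k by blast
  with S lt show ?thesis by blast
qed

lemma dominated_seed_mutates:
  fixes emb :: "'p::semifield \<Rightarrow> 'f"
  assumes "dominated x D j" "quiver n B" "large_weights_along n B ks" "set ks \<subseteq> {1..n}"
    "distinct_adj (j # ks)" and emb: "\<And>p. emb p \<in> K \<and> emb p \<noteq> 0"
  shows "\<exists>x' y' D' j'. seed_mutates n emb ks (x, y, B) = (x', y', mutates ks B) \<and>
    dominated x' D' j' \<and> D j \<le> D' j' \<and> (ks \<noteq> [] \<longrightarrow> D j < D' j')"
  using assms(1-5)
proof (induction ks arbitrary: x y B D j)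
  case Nil
  then show ?case by (auto simp: seed_mutates_def)
next
  case (Cons k ks)
  have "k \<in> {1..n}" "k \<noteq> j" "large_weights n B"
    using Cons.prems by (auto simp: large_weights_along_Cons)
  from dominated_seed_mutate[where emb = emb and y = y,
      OF Cons.prems(1) this(1,2) Cons.prems(2) this(3) emb]
  obtain x1 y1 D1 where S: "seed_mutate n emb k (x, y, B) = (x1, y1, mutate k B)"
    and dom: "dominated x1 D1 k" and lt: "D j < D1 k" by blast
  have "quiver n (mutate k B)" "large_weights_along n (mutate k B) ks" "set ks \<subseteq> {1..n}"
    "distinct_adj (k # ks)"
    using Cons.prems quiver_mutate by (auto simp: large_weights_along_Cons)
  from Cons.IH[where y = y1, OF dom this] obtain x' y' D' j' where
    "seed_mutates n emb ks (x1, y1, mutate k B) = (x', y', mutates ks (mutate k B))"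
    "dominated x' D' j'" "D1 k \<le> D' j'" by blast
  moreover have "seed_mutates n emb (k # ks) (x, y, B) = seed_mutates n emb ks (x1, y1, mutate k B)"
    using S by (simp add: seed_mutates_def)
  ultimately have "seed_mutates n emb (k # ks) (x, y, B) = (x', y', mutates (k # ks) B)"
    "dominated x' D' j'" "D j \<le> D' j'" "D j < D' j'"
    using lt by simp_all
  then show ?case by blast
qed

end

theorem no_seed_cycle:
  fixes emb :: "'p::semifield \<Rightarrow> 'f::field"
  assumes n: "n \<ge> 2" and amb: "ambient_field n emb" and seed: "is_seed n emb (x, y, Q)"
    and lw: "large_weights_along n Q ks" and ks: "ks \<noteq> []" "set ks \<subseteq> {1..n}" "distinct_adj ks"
  shows "\<not> same_seed n (seed_mutates n emb ks (x, y, Q)) (x, y, Q)"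
proof
  assume same: "same_seed n (seed_mutates n emb ks (x, y, Q)) (x, y, Q)"
  let ?K = "range (zp_embed emb)"
  have emb1: "emb 1 = 1" and emb_mult: "\<And>p q. emb (p * q) = emb p * emb q"
    using amb unfolding ambient_field_def by auto
  have K1: "of_int c * emb p \<in> ?K" for c p by (rule zp_embed_range_single)
  have emb: "emb p \<in> ?K \<and> emb p \<noteq> 0" for p
  proof
    show "emb p \<in> ?K" using K1[of 1 p] by simp
    have "emb (inverse p) * emb p = 1" by (simp add: semifield_left_inverse emb1 flip: emb_mult)
    then show "emb p \<noteq> 0" by auto
  qed
  \<comment> \<open>A virtual previous mutation: putting \<open>j\<close> in front of the word must
    keep adjacent letters distinct, and a second vertex exists since
    \<open>n \<ge> 2\<close>.\<close>
  obtain j where j: "j \<in> {1..n}" "j \<noteq> hd ks"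
  proof (cases "hd ks = 1")
    case True with that[of 2] n show ?thesis by simp
  next
    case False with that[of 1] n show ?thesis by simp
  qed
  \<comment> \<open>Vertex \<open>j\<close> takes the prime of index \<open>n + 1\<close>, beyond
    all indices given to the other vertices, so it starts out dominant.\<close>
  define q where "q i = enumerate {p::nat. prime p} (if i = j then Suc n else i)" for i
  have inf: "infinite {p::nat. prime p}" by (rule primes_infinite)
  have prime: "prime (q i)" for i using enumerate_in_set[OF inf] by (simp add: q_def)
  have q_less: "q i < q j" if "i \<in> {1..n} - {j}" for i
    using that inf by (simp add: q_def)
  have inj: "inj_on q {1..n}"
  proof (rule inj_onI)
    fix a b assume ab: "a \<in> {1..n}" "b \<in> {1..n}" "q a = q b"
    then have "(if a = j then Suc n else a) = (if b = j then Suc n else b)"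
      unfolding q_def by (simp only: strict_mono_eq[OF strict_mono_enumerate[OF inf]])
    with ab show "a = b" by (auto split: if_splits)
  qed
  let ?w = "\<lambda>i. real (q i)"
  interpret monomial_valuation n ?K x ?w
  proof
    show "- 1 \<in> ?K" using K1[of "-1" 1] by (simp add: emb1)
    show "algebraically_independent n ?K x"
      using seed zp_embed_range_subset_fractions[of emb, OF emb1] algebraically_independent_mono
      unfolding is_seed_def free_generating_set_def by auto
    show "a + b \<in> ?K" if "a \<in> ?K" "b \<in> ?K" for a b using that by (rule zp_embed_range_add)
    show "a * b \<in> ?K" if "a \<in> ?K" "b \<in> ?K" for a b
      using emb_mult that by (rule zp_embed_range_mult)
    show "?w i > 0" for i using prime[of i] by (simp add: prime_gt_0_nat)
  qed
  have val_x: "val (x i) (?w i)" if "i \<in> {1..n}" for i by (intro lead_val lead_gen that)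
  have "dominated x ?w j"
    unfolding dominated_def
    using j val_x mult_indep_primes[OF inj prime] q_less prime_ge_1_nat[OF prime] by auto
  moreover have "quiver n Q" using seed by (simp add: is_seed_def)
  moreover have "distinct_adj (j # ks)" using ks j by (cases ks) auto
  ultimately obtain x' y' D' j' where
    S: "seed_mutates n emb ks (x, y, Q) = (x', y', mutates ks Q)"
    and dom: "dominated x' D' j'" and lt: "?w j < D' j'"
    using dominated_seed_mutates[where emb = emb and y = y, OF _ _ lw ks(2) _ emb] ks(1) by blast
  have j': "j' \<in> {1..n}" and "val (x' j') (D' j')" using dom unfolding dominated_def by auto
  moreover have "x' j' = x j'" using same j' unfolding S same_seed_def by simp
  ultimately have "D' j' = ?w j'" using val_x[OF j'] val_unique by metis
  \<comment> \<open>The final dominant variable would have to equal an initial one, whose weight is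
    at most that of \<open>j\<close>; but its degree has grown strictly past that weight.\<close>
  moreover have "?w j' \<le> ?w j" using q_less[of j'] j' by (cases "j' = j") auto
  ultimately show False using lt by simp
qed

declare One_nat_def [simp del]

section \<open>The special mutation cycle\<close>

lemma large_weights_along_append:
  "large_weights_along n B (ks @ ls) \<longleftrightarrow>
     large_weights_along n B ks \<and> large_weights_along n (mutates ks B) ls"
proof (induction ks arbitrary: B)
  case Nil
  have "large_weights n B" if "large_weights_along n B ls"
    using that unfolding large_weights_along_def by (metis le0 mutates_Nil take0)
  then show ?case by (auto simp: large_weights_along_Nil)
qed (simp add: large_weights_along_Cons)

lemma quiver_mutates: "quiver n B \<Longrightarrow> set ks \<subseteq> {1..n} \<Longrightarrow> quiver n (mutates ks B)"
  by (induction ks arbitrary: B) (simp_all add: quiver_mutate)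

lemma repeat_word_0 [simp]: "repeat_word 0 w = []"
  and repeat_word_Suc [simp]: "repeat_word (Suc k) w = w @ repeat_word k w"
  by (simp_all add: repeat_word_def)

lemma repeat_word_Suc_right: "repeat_word (Suc k) w = repeat_word k w @ w"
  by (induction k) simp_all

section \<open>Second-order recurrences\<close>

fun recur :: "int \<Rightarrow> int \<Rightarrow> int \<Rightarrow> nat \<Rightarrow> int" where
  "recur a s t 0 = s"
| "recur a s t (Suc 0) = t"
| "recur a s t (Suc (Suc m)) = a * recur a s t (Suc m) - recur a s t m"

text \<open>For \<open>a \<ge> 2\<close> and a nonnegative term, each increment is at least the
  previous one. The first increment \<open>t - s\<close> is positive.\<close>

lemma recur_ge:
  assumes "a \<ge> 2" "s \<le> 0" "t \<ge> 2"
  shows "recur a s t (Suc m) \<ge> 2 \<and> recur a s t (Suc m) \<ge> recur a s t m"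
proof (induction m)
  case (Suc m)
  have "2 * recur a s t (Suc m) \<le> a * recur a s t (Suc m)"
    using Suc assms by (intro mult_right_mono) auto
  with Suc show ?case unfolding recur.simps by linarith
qed (use assms in simp)

text \<open>
  The left-hand side depends only on \<open>m + l\<close>. This makes the arrows between \<open>j \<ge> 3\<close> and \<open>n\<close> gained
  while reflecting at \<open>2, 1\<close> in the middle of the cycle cancel against those lost in its last two steps.
\<close>

lemma recur_exchange:
  "recur a s t (Suc m) * recur a s' t' (Suc l) - recur a s t m * recur a s' t' l =
   recur a s t (Suc (m + l)) * t' - recur a s t (m + l) * s'"
proof (induction l arbitrary: m)
  case (Suc l)
  from Suc[of "Suc m"] show ?case by (simp add: algebra_simps)
qed simp

section \<open>Mutation at sinks\<close>

definition flip :: "nat set \<Rightarrow> (nat \<Rightarrow> nat \<Rightarrow> int) \<Rightarrow> nat \<Rightarrow> nat \<Rightarrow> int" where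
  "flip S B i j = (if (i \<in> S) = (j \<in> S) then B i j else - B i j)"

lemma large_weights_flip: "large_weights n (flip S B) \<longleftrightarrow> large_weights n B"
proof -
  have "\<bar>flip S B i j\<bar> = \<bar>B i j\<bar>" for i j by (simp add: flip_def)
  then show ?thesis by (simp add: large_weights_def)
qed

lemma large_weights_cong: "same_quiver n B B' \<Longrightarrow> large_weights n B \<longleftrightarrow> large_weights n B'"
  by (simp add: large_weights_def same_quiver_def)

text \<open>No directed path passes through a sink, so mutation only reverses its arrows. The
  diagonal entry, which \<open>flip\<close> leaves alone, is zero by skew-symmetry.\<close>

lemma mutate_sink:
  assumes "quiver n B" "l \<in> {1..n}" "\<And>i. i \<in> {1..n} \<Longrightarrow> B i l \<ge> 0"
  shows "same_quiver n (mutate l B) (flip {l} B)"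
  unfolding same_quiver_def
proof (intro ballI)
  fix i j assume ij: "i \<in> {1..n}" "j \<in> {1..n}"
  have "B l j = - B j l" "B l l = - B l l" using assms ij unfolding quiver_def by blast+
  with assms(3)[OF ij(1)] assms(3)[OF ij(2)] show "mutate l B i j = flip {l} B i j"
    by (auto simp: mutate_eq flip_def)
qed

text \<open>Once \<open>l + 1, ..., n - 1\<close> have been mutated, the arrows from
  \<open>l\<close> to them are reversed, while arrows from smaller vertices and from
  \<open>n\<close> already enter \<open>l\<close>. So each vertex is a sink when its turn comes, and
  the reversals compose to one \<open>flip\<close>.\<close>

lemma mutates_sinks:
  assumes B: "quiver n B" "large_weights n B" and l: "1 \<le> l" "l \<le> n"
    and sink: "\<And>i j. 1 \<le> i \<Longrightarrow> l \<le> j \<Longrightarrow> j < n \<Longrightarrow> i < j \<Longrightarrow> B i j \<ge> 0"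
      "\<And>j. l \<le> j \<Longrightarrow> j < n \<Longrightarrow> B n j \<ge> 0"
  shows "same_quiver n (mutates (rev [l..<n]) B) (flip {l..<n} B) \<and>
    large_weights_along n B (rev [l..<n])"
  using l(2) l(1) sink
proof (induction rule: inc_induct)
  case base
  then show ?case by (simp add: same_quiver_def flip_def large_weights_along_Nil B)
next
  case (step l)
  let ?B = "mutates (rev [Suc l..<n]) B"
  have IH: "same_quiver n ?B (flip {Suc l..<n} B)" "large_weights_along n B (rev [Suc l..<n])"
    using step.IH step.prems by auto
  have rev: "rev [l..<n] = rev [Suc l..<n] @ [l]"
    using step by (simp add: upt_conv_Cons)
  have l: "l \<in> {1..n}" using step by simp
  have "quiver n ?B" using B(1) by (rule quiver_mutates) auto
  moreover have "?B i l \<ge> 0" if i: "i \<in> {1..n}" for i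
  proof -
    have skew: "B i l = - B l i" "B l l = - B l l" using B(1) i l unfolding quiver_def by blast+
    have "?B i l = flip {Suc l..<n} B i l" using IH(1) i l unfolding same_quiver_def by blast
    then show ?thesis
      using skew i step(1,2) step.prems(2)[of i l] step.prems(2)[of l i] step.prems(3)[of l] step.prems(1)
      by (cases i l rule: linorder_cases) (auto simp: flip_def)
  qed
  ultimately have "same_quiver n (mutate l ?B) (flip {l} ?B)" using mutate_sink l by blast
  moreover have "flip {l} ?B i j = flip {l..<n} B i j" if "i \<in> {1..n}" "j \<in> {1..n}" for i j
  proof -
    have "?B i j = flip {Suc l..<n} B i j" using IH(1) that unfolding same_quiver_def by blast
    then show ?thesis using step(1,2) unfolding flip_def by auto
  qed
  ultimately have same: "same_quiver n (mutates (rev [l..<n]) B) (flip {l..<n} B)"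
    unfolding rev mutates_append same_quiver_def by simp
  have "large_weights n ?B" using large_weights_cong[OF IH(1)] B(2) large_weights_flip by blast
  moreover have "large_weights n (mutate l ?B)"
    using large_weights_cong[OF same] B(2) large_weights_flip
    by (simp add: rev mutates_append)
  ultimately have "large_weights_along n B (rev [l..<n])"
    unfolding rev large_weights_along_append using IH(2)
    by (simp add: large_weights_along_Cons large_weights_along_Nil)
  with same show ?case ..
qed

section \<open>Checking entries above the diagonal\<close>

lemma quiver_diag: "quiver n B \<Longrightarrow> i \<in> {1..n} \<Longrightarrow> B i i = 0"
  unfolding quiver_def by (metis add.inverse_inverse eq_neg_iff_add_eq_0 mult_2 mult_eq_0_iff zero_neq_numeral)

lemma quiver_cases_lt:
  assumes "n \<ge> 4" "1 \<le> i" "i < j" "j \<le> (n::nat)"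
  obtains "i = 1" "j = 2" | "i = 1" "j \<in> {3..<n}" | "i = 2" "j \<in> {3..<n}"
    | "i \<in> {3..<n}" "j \<in> {3..<n}" | "i \<in> {1..<n}" "j = n"
  using assms by force

lemma large_weightsI:
  assumes "quiver n B" "n \<ge> 4" "\<bar>B 1 2\<bar> \<ge> 2"
    and "\<And>j. j \<in> {3..<n} \<Longrightarrow> \<bar>B 1 j\<bar> \<ge> 2 \<and> \<bar>B 2 j\<bar> \<ge> 2"
    and "\<And>i j. i \<in> {3..<n} \<Longrightarrow> j \<in> {3..<n} \<Longrightarrow> i < j \<Longrightarrow> \<bar>B i j\<bar> \<ge> 2"
    and "\<bar>B 1 n\<bar> \<ge> 2" "\<bar>B 2 n\<bar> \<ge> 2" "\<And>j. j \<in> {3..<n} \<Longrightarrow> \<bar>B j n\<bar> \<ge> 2"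
  shows "large_weights n B"
proof -
  have lt: "\<bar>B i j\<bar> \<ge> 2" if "1 \<le> i" "i < j" "j \<le> n" for i j
    using assms(2) that
  proof (cases rule: quiver_cases_lt)
    case 1
    then show ?thesis using assms(3) by simp
  next
    case 5
    then consider "i = 1" | "i = 2" | "i \<in> {3..<n}" by force
    then show ?thesis using 5 assms by cases auto
  qed (use assms that in auto)
  show ?thesis
    unfolding large_weights_def
  proof (intro ballI impI)
    fix i j assume ij: "i \<in> {1..n}" "j \<in> {1..n}" "i \<noteq> j"
    have "B i j = - B j i" using assms(1) ij unfolding quiver_def by blast
    then show "\<bar>B i j\<bar> \<ge> 2" using lt[of i j] lt[of j i] ij by (cases "i < j") auto
  qed
qed

section \<open>Alternating mutations at \<open>1\<close> and \<open>2\<close>\<close>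

locale two_vertex_cycle =
  fixes n :: nat and R :: "nat \<Rightarrow> nat \<Rightarrow> int" and v1 v2 :: int
  assumes n: "n \<ge> 4"
    and R: "quiver (n - 1) R"
      "\<And>i j. 1 \<le> i \<Longrightarrow> i < j \<Longrightarrow> j < n \<Longrightarrow> R i j \<ge> 2"
    and v: "v1 \<ge> 2" "v2 \<ge> 2"
begin

abbreviation a :: int where "a \<equiv> R 1 2"

text \<open>The initial values are chosen so that \<open>R\<close> itself satisfies
  \<open>rows_at 2 1 0\<close>.\<close>

definition C :: "nat \<Rightarrow> nat \<Rightarrow> int" where
  "C j m = recur a (- R 1 j) (R 2 j) m"

text \<open>The initial values are the arrows at \<open>n\<close> after the first mutation, which
  reverses them: \<open>column_at 2 1 0\<close> then reads \<open>B 1 n = - v1\<close> and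
  \<open>B 2 n = - v2\<close>.\<close>

definition E :: "nat \<Rightarrow> int" where
  "E m = recur a (- v2) v1 m"

lemma a_ge: "a \<ge> 2"
  using R(2)[of 1 2] n by simp

lemma C_Suc_Suc: "C j (Suc (Suc m)) = a * C j (Suc m) - C j m"
  and E_Suc_Suc: "E (Suc (Suc m)) = a * E (Suc m) - E m"
  by (simp_all add: C_def E_def)

lemma C_ge: "j \<in> {3..<n} \<Longrightarrow> C j (Suc m) \<ge> 2"
  using recur_ge[of a "- R 1 j" "R 2 j" m] a_ge R(2)[of 1 j] R(2)[of 2 j] by (simp add: C_def)

lemma E_ge: "E (Suc m) \<ge> 2"
  using recur_ge[of a "- v2" v1 m] a_ge v by (simp add: E_def)

lemma C_abs: "j \<in> {3..<n} \<Longrightarrow> \<bar>C j m\<bar> \<ge> 2"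
  using C_ge[of j "m - 1"] R(2)[of 1 j] by (cases m) (auto simp: C_def)

lemma E_abs: "\<bar>E m\<bar> \<ge> 2"
  using E_ge[of "m - 1"] v by (cases m) (auto simp: E_def)

text \<open>
  Starting from \<open>R\<close>, mutating \<open>m\<close> times alternately at \<open>2\<close> and \<open>1\<close> leads to \<open>rows_at p q m\<close>, where \<open>p\<close> is
  the vertex mutated next. Mutating at \<open>q\<close> instead undoes the last step. \<open>column_at\<close> describes the
  arrows at \<open>n\<close> in the same situation; its index moves in the opposite direction.
\<close>

definition rows_at :: "nat \<Rightarrow> nat \<Rightarrow> nat \<Rightarrow> (nat \<Rightarrow> nat \<Rightarrow> int) \<Rightarrow> bool" where
  "rows_at p q m B \<longleftrightarrow> B q p = a \<and> B p q = - a \<and>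
     (\<forall>j\<in>{3..<n}. B p j = C j (Suc m) \<and> B j p = - C j (Suc m) \<and> B q j = - C j m \<and> B j q = C j m) \<and>
     (\<forall>i\<in>{3..<n}. \<forall>j\<in>{3..<n}. B i j = R i j)"

definition column_at :: "nat \<Rightarrow> nat \<Rightarrow> nat \<Rightarrow> (nat \<Rightarrow> int) \<Rightarrow> (nat \<Rightarrow> nat \<Rightarrow> int) \<Rightarrow> bool" where
  "column_at p q l r B \<longleftrightarrow> B q n = - E (Suc l) \<and> B n q = E (Suc l) \<and> B p n = E l \<and> B n p = - E l \<and>
     (\<forall>j\<in>{3..<n}. B j n = r j \<and> B n j = - r j)"

text \<open>The only arrows into \<open>p\<close> from \<open>[1,n-1]\<close> come from
  \<open>q\<close>, and all middle vertices lie behind \<open>p\<close>. Hence only the row of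
  \<open>q\<close> gains arrows, which is one step of the recurrence, and the arrows among
  \<open>3, ..., n - 1\<close> stay fixed.\<close>

lemma rows_at_up:
  assumes rows_at: "rows_at p q m B" and pq: "(p, q) = (1, 2) \<or> (p, q) = (2, 1)"
  shows "rows_at q p (Suc m) (mutate p B)"
proof -
  have pq': "p \<noteq> q" "q \<noteq> p" "p \<notin> {3..<n}" "q \<notin> {3..<n}" using pq by auto
  have ne: "j \<noteq> p \<and> j \<noteq> q" if "j \<in> {3..<n}" for j using that pq by auto
  have e: "B q p = a" "B p q = - a" using rows_at unfolding rows_at_def by auto
  have ej: "B p j = C j (Suc m)" "B j p = - C j (Suc m)" "B q j = - C j m" "B j q = C j m"
    if "j \<in> {3..<n}" for j using rows_at that unfolding rows_at_def by auto
  have eij: "B i j = R i j" if "i \<in> {3..<n}" "j \<in> {3..<n}" for i j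
    using rows_at that unfolding rows_at_def by auto
  have pos: "C j (Suc m) > 0" if "j \<in> {3..<n}" for j using C_ge[OF that, of m] by simp
  show ?thesis
    unfolding rows_at_def
  proof (intro conjI ballI)
    fix j assume j: "j \<in> {3..<n}"
    note f = ne[OF j] ej[OF j] pos[OF j] a_ge e pq'
    show "mutate p B q j = C j (Suc (Suc m))" "mutate p B j q = - C j (Suc (Suc m))"
      "mutate p B p j = - C j (Suc m)" "mutate p B j p = C j (Suc m)"
      using f by (auto simp: mutate_eq C_Suc_Suc)
    fix i assume i: "i \<in> {3..<n}"
    show "mutate p B i j = R i j"
      using f eij[OF i j] ne[OF i] ej[OF i] pos[OF i] by (auto simp: mutate_eq)
  qed (use e pq' in \<open>auto simp: mutate_eq\<close>)
qed

text \<open>Now all middle vertices point to \<open>q\<close> and only \<open>p\<close> among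
  \<open>[1,n-1]\<close> lies behind it. The recurrence is solved for its earlier term.\<close>

lemma rows_at_down:
  assumes rows_at: "rows_at p q (Suc m) B" and pq: "(p, q) = (1, 2) \<or> (p, q) = (2, 1)"
  shows "rows_at q p m (mutate q B)"
proof -
  have pq': "p \<noteq> q" "q \<noteq> p" "p \<notin> {3..<n}" "q \<notin> {3..<n}" using pq by auto
  have ne: "j \<noteq> p \<and> j \<noteq> q" if "j \<in> {3..<n}" for j using that pq by auto
  have e: "B q p = a" "B p q = - a" using rows_at unfolding rows_at_def by auto
  have ej: "B p j = C j (Suc (Suc m))" "B j p = - C j (Suc (Suc m))" "B q j = - C j (Suc m)"
    "B j q = C j (Suc m)"
    if "j \<in> {3..<n}" for j using rows_at that unfolding rows_at_def by auto
  have eij: "B i j = R i j" if "i \<in> {3..<n}" "j \<in> {3..<n}" for i j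
    using rows_at that unfolding rows_at_def by auto
  have pos: "C j (Suc m) > 0" if "j \<in> {3..<n}" for j using C_ge[OF that, of m] by simp
  show ?thesis
    unfolding rows_at_def
  proof (intro conjI ballI)
    fix j assume j: "j \<in> {3..<n}"
    note f = ne[OF j] ej[OF j] pos[OF j] a_ge e pq'
    show "mutate q B q j = C j (Suc m)" "mutate q B j q = - C j (Suc m)"
      "mutate q B p j = - C j m" "mutate q B j p = C j m"
      using f by (auto simp: mutate_eq C_Suc_Suc)
    fix i assume i: "i \<in> {3..<n}"
    show "mutate q B i j = R i j"
      using f eij[OF i j] ne[OF i] ej[OF i] pos[OF i] by (auto simp: mutate_eq)
  qed (use e pq' in \<open>auto simp: mutate_eq\<close>)
qed

text \<open>Both \<open>n\<close> and the middle vertices are targets of \<open>p\<close>, so the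
  arrows \<open>r\<close> between them do not change. This needs \<open>E (Suc l) > 0\<close>; at
  column index 0 the sign of \<open>E\<close> is different and \<open>phase_end\<close> takes
  over.\<close>

lemma column_at_up:
  assumes rows_at: "rows_at p q m B" and column_at: "column_at p q (Suc l) r B" and pq: "(p, q) = (1, 2) \<or> (p, q) = (2, 1)"
  shows "column_at q p l r (mutate p B)"
proof -
  have pq': "p \<noteq> q" "q \<noteq> p" "n \<noteq> p" "n \<noteq> q" "p \<noteq> n" "q \<noteq> n" using pq n by auto
  have e: "B q p = a" "B p q = - a" using rows_at unfolding rows_at_def by auto
  have ej: "B p j = C j (Suc m)" "B j p = - C j (Suc m)" "B j n = r j" "B n j = - r j"
    "j \<noteq> p" "j \<noteq> q" "C j (Suc m) > 0"
    if "j \<in> {3..<n}" for j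
    using rows_at column_at that pq C_ge[OF that, of m] unfolding rows_at_def column_at_def by auto
  have en: "B q n = - E (Suc (Suc l))" "B n q = E (Suc (Suc l))" "B p n = E (Suc l)"
    "B n p = - E (Suc l)" using column_at unfolding column_at_def by auto
  have pos: "E (Suc l) > 0" using E_ge[of l] by simp
  show ?thesis
    unfolding column_at_def
  proof (intro conjI ballI)
    fix j assume j: "j \<in> {3..<n}"
    show "mutate p B j n = r j" "mutate p B n j = - r j"
      using ej[OF j] en pos pq' by (auto simp: mutate_eq)
  qed (use e en pos pq' a_ge in \<open>auto simp: mutate_eq E_Suc_Suc\<close>)
qed

lemma column_at_down:
  assumes rows_at: "rows_at p q (Suc m) B" and column_at: "column_at p q l r B" and pq: "(p, q) = (1, 2) \<or> (p, q) = (2, 1)"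
  shows "column_at q p (Suc l) r (mutate q B)"
proof -
  have pq': "p \<noteq> q" "q \<noteq> p" "n \<noteq> p" "n \<noteq> q" "p \<noteq> n" "q \<noteq> n" using pq n by auto
  have e: "B q p = a" "B p q = - a" using rows_at unfolding rows_at_def by auto
  have ej: "B q j = - C j (Suc m)" "B j q = C j (Suc m)" "B j n = r j" "B n j = - r j"
    "j \<noteq> p" "j \<noteq> q" "C j (Suc m) > 0"
    if "j \<in> {3..<n}" for j
    using rows_at column_at that pq C_ge[OF that, of m] unfolding rows_at_def column_at_def by auto
  have en: "B q n = - E (Suc l)" "B n q = E (Suc l)" "B p n = E l"
    "B n p = - E l" using column_at unfolding column_at_def by auto
  have pos: "E (Suc l) > 0" using E_ge[of l] by simp
  show ?thesis
    unfolding column_at_def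
  proof (intro conjI ballI)
    fix j assume j: "j \<in> {3..<n}"
    show "mutate q B j n = r j" "mutate q B n j = - r j"
      using ej[OF j] en pos pq' by (auto simp: mutate_eq)
  qed (use e en pos pq' a_ge in \<open>auto simp: mutate_eq E_Suc_Suc\<close>)
qed

section \<open>The segments of the special cycle\<close>

lemma rows_at_large:
  assumes "rows_at p q m B" "(p, q) = (1, 2) \<or> (p, q) = (2, 1)" "quiver n B"
    "\<bar>B 1 n\<bar> \<ge> 2" "\<bar>B 2 n\<bar> \<ge> 2" "\<And>j. j \<in> {3..<n} \<Longrightarrow> \<bar>B j n\<bar> \<ge> 2"
  shows "large_weights n B"
proof (rule large_weightsI[OF assms(3) n _ _ _ assms(4-6)])
  show "\<bar>B 1 2\<bar> \<ge> 2" using assms(1,2) a_ge unfolding rows_at_def by auto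
  show "\<bar>B 1 j\<bar> \<ge> 2 \<and> \<bar>B 2 j\<bar> \<ge> 2" if "j \<in> {3..<n}" for j
    using assms(1,2) that C_abs[OF that] unfolding rows_at_def by auto
  show "\<bar>B i j\<bar> \<ge> 2" if "i \<in> {3..<n}" "j \<in> {3..<n}" "i < j" for i j
    using assms(1) that R(2)[of i j] unfolding rows_at_def by auto
qed

lemma rows_column_large:
  assumes "rows_at p q m B" "column_at p q l r B" "(p, q) = (1, 2) \<or> (p, q) = (2, 1)" "quiver n B"
    "\<And>j. j \<in> {3..<n} \<Longrightarrow> \<bar>r j\<bar> \<ge> 2"
  shows "large_weights n B"
  using assms(2-) E_abs by (intro rows_at_large[OF assms(1)]) (auto simp: column_at_def)

lemma rows_at_phase_up: "rows_at 2 1 m B \<Longrightarrow> rows_at 2 1 (m + 2 * k) (mutates (repeat_word k [2, 1]) B)"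
proof (induction k arbitrary: m B)
  case (Suc k)
  have "rows_at 2 1 (Suc (Suc m)) (mutate 1 (mutate 2 B))"
    using Suc.prems by (intro rows_at_up) auto
  from Suc.IH[OF this] show ?case by simp
qed simp

lemma phase_up:
  assumes "rows_at 2 1 m B" "column_at 2 1 (2 * k + l) r B" "quiver n B"
    and r: "\<And>j. j \<in> {3..<n} \<Longrightarrow> \<bar>r j\<bar> \<ge> 2"
  shows "column_at 2 1 l r (mutates (repeat_word k [2, 1]) B) \<and>
    large_weights_along n B (repeat_word k [2, 1])"
  using assms(1-3)
proof (induction k arbitrary: m B)
  case 0
  then show ?case using rows_column_large[OF _ _ _ _ r] by (auto simp: large_weights_along_Nil)
next
  case (Suc k)
  let ?B1 = "mutate 2 B" and ?B2 = "mutate 1 (mutate 2 B)"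
  have column_at: "column_at 2 1 (Suc (Suc (2 * k + l))) r B" using Suc.prems(2) by simp
  have q: "quiver n ?B1" "quiver n ?B2" using Suc.prems(3) n by (auto intro!: quiver_mutate)
  have U1: "rows_at 1 2 (Suc m) ?B1" and V1: "column_at 1 2 (Suc (2 * k + l)) r ?B1"
    using rows_at_up[OF Suc.prems(1)] column_at_up[OF Suc.prems(1) column_at] by auto
  have U2: "rows_at 2 1 (Suc (Suc m)) ?B2" and V2: "column_at 2 1 (2 * k + l) r ?B2"
    using rows_at_up[OF U1] column_at_up[OF U1 V1] by auto
  have "large_weights n B" "large_weights n ?B1"
    using rows_column_large[OF Suc.prems(1,2) _ Suc.prems(3) r] rows_column_large[OF U1 V1 _ q(1) r] by auto
  with Suc.IH[OF U2 V2 q(2)] show ?case by (simp add: large_weights_along_Cons)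
qed

lemma phase_down:
  assumes "rows_at 2 1 (2 * k) B" "column_at 2 1 l r B" "quiver n B"
    and r: "\<And>j. j \<in> {3..<n} \<Longrightarrow> \<bar>r j\<bar> \<ge> 2"
  shows "rows_at 2 1 0 (mutates (repeat_word k [1, 2]) B) \<and>
    column_at 2 1 (l + 2 * k) r (mutates (repeat_word k [1, 2]) B) \<and>
    large_weights_along n B (repeat_word k [1, 2])"
  using assms(1-3)
proof (induction k arbitrary: l B)
  case 0
  then show ?case using rows_column_large[OF _ _ _ _ r] by (auto simp: large_weights_along_Nil)
next
  case (Suc k)
  let ?B1 = "mutate 1 B" and ?B2 = "mutate 2 (mutate 1 B)"
  have rows_at: "rows_at 2 1 (Suc (Suc (2 * k))) B" using Suc.prems(1) by simp
  have q: "quiver n ?B1" "quiver n ?B2" using Suc.prems(3) n by (auto intro!: quiver_mutate)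
  have U1: "rows_at 1 2 (Suc (2 * k)) ?B1" and V1: "column_at 1 2 (Suc l) r ?B1"
    using rows_at_down[OF rows_at] column_at_down[OF rows_at Suc.prems(2)] by auto
  have U2: "rows_at 2 1 (2 * k) ?B2" and V2: "column_at 2 1 (Suc (Suc l)) r ?B2"
    using rows_at_down[OF U1] column_at_down[OF U1 V1] by auto
  have "large_weights n B" "large_weights n ?B1"
    using rows_column_large[OF Suc.prems(1,2) _ Suc.prems(3) r] rows_column_large[OF U1 V1 _ q(1) r] by auto
  with Suc.IH[OF U2 V2 q(2)] show ?case by (simp add: large_weights_along_Cons)
qed

text \<open>The letters 2, 1 that end the descending run. Vertex 2 is not a sink here, since it has
  arrows to \<open>n\<close>; paths from a middle vertex \<open>j\<close> through 2 and then through
  1 add the two products in \<open>r\<close>.\<close>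

lemma phase_middle:
  assumes q: "quiver n G"
    and e: "G 1 2 = a" "G 1 n = - E (Suc (Suc (Suc l)))" "G 2 n = E (Suc (Suc l))"
    and ej: "\<And>j. j \<in> {3..<n} \<Longrightarrow> G 1 j = - R 1 j \<and> G 2 j = - R 2 j \<and> G j n = x j"
    and eij: "\<And>i j. i \<in> {3..<n} \<Longrightarrow> j \<in> {3..<n} \<Longrightarrow> G i j = R i j"
    and x: "\<And>j. j \<in> {3..<n} \<Longrightarrow> x j \<ge> 2"
  defines "r \<equiv> \<lambda>j. x j + R 2 j * E (Suc (Suc l)) + R 1 j * E (Suc l)"
  shows "rows_at 2 1 0 (mutates [2, 1] G)" "column_at 2 1 l r (mutates [2, 1] G)"
    "large_weights_along n G [2, 1]" "\<And>j. j \<in> {3..<n} \<Longrightarrow> r j \<ge> 2"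
proof -
  let ?G1 = "mutate 2 G" and ?G2 = "mutate 1 (mutate 2 G)"
  have skew: "B i j = - B j i" if "quiver n B" "i \<in> {1..n}" "j \<in> {1..n}" for B i j
    using that unfolding quiver_def by blast
  have q1: "quiver n ?G1" and q2: "quiver n ?G2" using q n by (auto intro!: quiver_mutate)
  have pos: "E (Suc l) \<ge> 2" "E (Suc (Suc l)) \<ge> 2" by (rule E_ge)+
  have Rj: "R 1 j \<ge> 2" "R 2 j \<ge> 2" if "j \<in> {3..<n}" for j using R(2)[of 1 j] R(2)[of 2 j] that by auto
  have n2: "n \<noteq> 1" "n \<noteq> 2" "n \<noteq> Suc 0" using n by auto
  have ej': "G j 1 = R 1 j" "G j 2 = R 2 j" if "j \<in> {3..<n}" for j
    using skew[OF q, of j 1] skew[OF q, of j 2] ej[OF that] that n by auto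
  have e': "G 2 1 = - a" using skew[OF q, of 2 1] e n by auto
  have f: "?G1 1 2 = - a" "?G1 1 n = E (Suc l)" "?G1 2 n = - E (Suc (Suc l))"
    using e a_ge pos n2 by (auto simp: mutate_eq E_Suc_Suc[of "Suc l"])
  have fj: "?G1 1 j = - R 1 j" "?G1 2 j = R 2 j" "?G1 j n = x j + R 2 j * E (Suc (Suc l))"
    if "j \<in> {3..<n}" for j
    using e ej[OF that] ej'[OF that] Rj[OF that] pos a_ge that n2 by (auto simp: mutate_eq)
  have fij: "?G1 i j = R i j" if "i \<in> {3..<n}" "j \<in> {3..<n}" for i j
    using ej[OF that(2)] ej'[OF that(1)] Rj[OF that(1)] Rj[OF that(2)] eij[OF that] that
    by (auto simp: mutate_eq)
  have f': "?G1 2 1 = a" using skew[OF q1, of 2 1] f n by auto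
  have fj': "?G1 j 1 = R 1 j" if "j \<in> {3..<n}" for j
    using skew[OF q1, of j 1] fj[OF that] that n by auto
  have g: "?G2 1 2 = a" "?G2 1 n = - E (Suc l)" "?G2 2 n = E l"
    using f f' a_ge pos n2 by (auto simp: mutate_eq[of 1] E_Suc_Suc[of l])
  have gj: "?G2 1 j = R 1 j" "?G2 2 j = R 2 j" "?G2 j n = r j"
    if "j \<in> {3..<n}" for j
    using f f' fj[OF that] fj'[OF that] Rj[OF that] pos a_ge that n2
    by (auto simp: mutate_eq[of 1] r_def)
  have gij: "?G2 i j = R i j" if "i \<in> {3..<n}" "j \<in> {3..<n}" for i j
    using fj[OF that(2)] fj'[OF that(1)] Rj[OF that(1)] Rj[OF that(2)] fij[OF that] that
    by (auto simp: mutate_eq[of 1])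
  have "?G2 2 1 = - a" "?G2 n 1 = E (Suc l)" "?G2 n 2 = - E l"
    using skew[OF q2, of 2 1] skew[OF q2, of n 1] skew[OF q2, of n 2] g n by auto
  moreover have "?G2 j 1 = - R 1 j" "?G2 j 2 = - R 2 j" "?G2 n j = - r j" if "j \<in> {3..<n}" for j
    using skew[OF q2, of j 1] skew[OF q2, of j 2] skew[OF q2, of n j] gj[OF that] that n by auto
  ultimately show "rows_at 2 1 0 (mutates [2, 1] G)" and "column_at 2 1 l r (mutates [2, 1] G)"
    using g gj gij unfolding rows_at_def column_at_def by (auto simp: C_def)
  then have UV2: "rows_at 2 1 0 ?G2" "column_at 2 1 l r ?G2" by simp_all
  have prod_pos: "R 2 j * E (Suc (Suc l)) \<ge> 0" "R 1 j * E (Suc l) \<ge> 0" if "j \<in> {3..<n}" for j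
    using Rj[OF that] pos by auto
  show r: "r j \<ge> 2" if "j \<in> {3..<n}" for j
    using x[OF that] prod_pos[OF that] by (simp add: r_def)
  have abs: "\<bar>R 1 j\<bar> \<ge> 2" "\<bar>R 2 j\<bar> \<ge> 2" "\<bar>x j\<bar> \<ge> 2" if "j \<in> {3..<n}" for j
    using Rj[OF that] x[OF that] by auto
  have absR: "\<bar>R i j\<bar> \<ge> 2" if "i \<in> {3..<n}" "j \<in> {3..<n}" "i < j" for i j
    using R(2)[of i j] that by auto
  have "large_weights n G"
    using e ej eij a_ge E_abs abs absR by (intro large_weightsI[OF q n]) auto
  moreover have "large_weights n ?G1"
  proof (rule large_weightsI[OF q1 n])
    show "\<bar>?G1 j n\<bar> \<ge> 2" if "j \<in> {3..<n}" for j
      using fj(3)[OF that] x[OF that] prod_pos[OF that] by simp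
  qed (use f fj fij a_ge E_abs abs absR in auto)
  moreover have "large_weights n ?G2"
    by (rule rows_column_large[OF UV2 _ q2]) (use r in force)+
  ultimately show "large_weights_along n G [2, 1]"
    by (simp add: large_weights_along_Cons large_weights_along_Nil)
qed

text \<open>At column index 0, \<open>n\<close> points to both 1 and 2, so paths from
  \<open>n\<close> through 2 and then 1 to \<open>j\<close> now oppose the arrows from
  \<open>j\<close> to \<open>n\<close>. They remove exactly the two products, first the
  \<open>v2\<close> term and then the \<open>v1\<close> term, and leave \<open>x j\<close>.\<close>

lemma phase_end:
  assumes rows_at: "rows_at 2 1 m B" and column_at: "column_at 2 1 0 r B" and q: "quiver n B"
    and r: "\<And>j. j \<in> {3..<n} \<Longrightarrow> r j = x j + C j (Suc (Suc m)) * v1 + C j (Suc m) * v2"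
    and x: "\<And>j. j \<in> {3..<n} \<Longrightarrow> x j \<ge> 2"
  shows "rows_at 2 1 (Suc (Suc m)) (mutates [2, 1] B)"
    "mutates [2, 1] B 1 n = v1" "mutates [2, 1] B 2 n = v2"
    "\<And>j. j \<in> {3..<n} \<Longrightarrow> mutates [2, 1] B j n = x j"
    "large_weights_along n B [2, 1]"
proof -
  let ?B1 = "mutate 2 B" and ?B2 = "mutate 1 (mutate 2 B)"
  have q1: "quiver n ?B1" and q2: "quiver n ?B2" using q n by (auto intro!: quiver_mutate)
  have U1: "rows_at 1 2 (Suc m) ?B1" using rows_at_up[OF rows_at] by simp
  have U2: "rows_at 2 1 (Suc (Suc m)) ?B2" using rows_at_up[OF U1] by simp
  then show "rows_at 2 1 (Suc (Suc m)) (mutates [2, 1] B)" by simp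
  have n2: "n \<noteq> 1" "n \<noteq> 2" "n \<noteq> Suc 0" using n by auto
  have e: "B 1 2 = a" "B 1 n = - v1" "B 2 n = - v2"
    using rows_at column_at unfolding rows_at_def column_at_def by (auto simp: E_def)
  have ej: "B j 2 = - C j (Suc m)" "B j n = r j" "C j (Suc m) \<ge> 2" "C j (Suc (Suc m)) \<ge> 2"
    if "j \<in> {3..<n}" for j
    using rows_at column_at that C_ge[OF that, of m] C_ge[OF that, of "Suc m"] unfolding rows_at_def column_at_def by auto
  have f: "?B1 1 n = - v1" "?B1 2 n = v2" "?B1 2 1 = a"
    using e n2 a_ge v U1 unfolding rows_at_def by (auto simp: mutate_eq[of 2])
  have fj: "?B1 j n = x j + C j (Suc (Suc m)) * v1" if "j \<in> {3..<n}" for j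
    using e ej[OF that] r[OF that] that n2 v by (auto simp: mutate_eq[of 2])
  have fj': "?B1 j 1 = - C j (Suc (Suc m))" if "j \<in> {3..<n}" for j
    using U1 that unfolding rows_at_def by auto
  have g: "?B2 1 n = v1" "?B2 2 n = v2"
    using f n2 a_ge v by (auto simp: mutate_eq[of 1])
  have gj: "?B2 j n = x j" if "j \<in> {3..<n}" for j
    using f fj[OF that] fj'[OF that] ej[OF that] that n2 v by (auto simp: mutate_eq[of 1])
  show "mutates [2, 1] B 1 n = v1" "mutates [2, 1] B 2 n = v2" using g by auto
  show "mutates [2, 1] B j n = x j" if "j \<in> {3..<n}" for j using gj[OF that] by simp
  have nonneg: "C j (Suc (Suc m)) * v1 \<ge> 0" "C j (Suc m) * v2 \<ge> 0" if "j \<in> {3..<n}" for j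
    using ej[OF that] v by auto
  have "large_weights n B"
    using e v r nonneg x ej(2) by (intro rows_at_large[OF rows_at _ q]) force+
  moreover have "large_weights n ?B1"
    using f v fj nonneg x by (intro rows_at_large[OF U1 _ q1]) force+
  moreover have "large_weights n ?B2"
    using g v gj x by (intro rows_at_large[OF U2 _ q2]) force+
  ultimately show "large_weights_along n B [2, 1]"
    by (simp add: large_weights_along_Cons large_weights_along_Nil)
qed

end

section \<open>The special word as a closed mutation sequence\<close>

lemma repeat_word_pair:
  assumes "x \<noteq> y"
  shows "distinct_adj (repeat_word k [x, y]) \<and> set (repeat_word k [x, y]) \<subseteq> {x, y} \<and>
    (k > 0 \<longrightarrow> repeat_word k [x, y] \<noteq> [] \<and> hd (repeat_word k [x, y]) = x \<and>
      last (repeat_word k [x, y]) = y)"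
  using assms by (induction k) (auto simp: distinct_adj_Cons)

lemma distinct_imp_distinct_adj: "distinct xs \<Longrightarrow> distinct_adj xs"
  by (simp add: distinct_adj_conv_nth nth_eq_iff_index_eq)

text \<open>At the junctions the letters are \<open>n, 1\<close>, then \<open>2, n - 1\<close>, then
  \<open>1, 2\<close>, and cyclically \<open>1, n\<close>; they differ because
  \<open>n \<ge> 4\<close>.\<close>

lemma special_sequence_adj:
  assumes "n \<ge> 4" "k > 0"
  shows "distinct_adj (special_sequence n k)" "hd (special_sequence n k) = n"
    "last (special_sequence n k) = 1" "set (special_sequence n k) \<subseteq> {1..n}"
    "special_sequence n k \<noteq> []"
proof -
  have rev: "distinct_adj (rev [1..<n])" "rev [1..<n] \<noteq> []" "hd (rev [1..<n]) = n - 1"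
    "last (rev [1..<n]) = 1"
    using assms by (auto simp: hd_rev last_rev intro: distinct_imp_distinct_adj)
  show "distinct_adj (special_sequence n k)" "last (special_sequence n k) = 1"
    "hd (special_sequence n k) = n" "special_sequence n k \<noteq> []"
    using rev repeat_word_pair[of 1 2 k] repeat_word_pair[of 2 1 k] assms
    by (auto simp: special_sequence_def distinct_adj_append_iff distinct_adj_Cons)
  show "set (special_sequence n k) \<subseteq> {1..n}"
    using repeat_word_pair[of 1 2 k] repeat_word_pair[of 2 1 k] assms
    by (auto simp: special_sequence_def)
qed

text \<open>Large weights and a second vertex exclude isolated vertices, and the condition on first
  and last letters closes up the adjacency condition.\<close>

lemma mutation_cycleI:
  assumes "n \<ge> 2" "quiver n Q" "set ks \<subseteq> {1..n}" "large_weights_along n Q ks"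
    "distinct_adj ks" "ks \<noteq> []" "hd ks \<noteq> last ks" "same_quiver n (mutates ks Q) Q"
  shows "mutation_cycle n Q ks"
  unfolding mutation_cycle_def
proof (intro conjI allI impI)
  fix m assume m: "m < length ks"
  show "ks ! m \<noteq> ks ! (Suc m mod length ks)"
  proof (cases "Suc m < length ks")
    case True
    then show ?thesis using assms(5) by (simp add: distinct_adj_nth)
  next
    case False
    then have "Suc m = length ks" using m by simp
    then show ?thesis using assms(6,7) m
      by (simp add: hd_conv_nth last_conv_nth flip: \<open>Suc m = length ks\<close>)
  qed
  let ?B = "mutates (take m ks) Q"
  have lw: "large_weights n ?B" using assms(4) m unfolding large_weights_along_def by simp
  have k: "ks ! m \<in> {1..n}" using assms(3) m nth_mem by blast
  obtain j where j: "j \<in> {1..n}" "j \<noteq> ks ! m"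
  proof (cases "ks ! m = 1")
    case True with that[of 2] assms(1) show ?thesis by simp
  next
    case False with that[of 1] assms(1) show ?thesis by simp
  qed
  have "\<bar>?B (ks ! m) j\<bar> \<ge> 2"
    using lw[unfolded large_weights_def, rule_format, OF k j(1)] j(2) by simp
  then show "\<not> isolated n ?B (ks ! m)" using j unfolding isolated_def by force
qed (use assms in auto)

section \<open>Assembly of the special cycle\<close>

context two_vertex_cycle
begin

lemma rows_at_start: "rows_at 2 1 0 R"
proof -
  have skew: "R i j = - R j i" if "i \<in> {1..n - 1}" "j \<in> {1..n - 1}" for i j
    using R(1) that unfolding quiver_def by blast
  have "R 2 1 = - a" by (rule skew) (use n in auto)
  moreover have "R j 1 = - R 1 j \<and> R j 2 = - R 2 j" if "j \<in> {3..<n}" for j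
    by (intro conjI skew) (use n that in auto)
  ultimately show ?thesis by (simp add: rows_at_def C_def)
qed

lemma rows_at_cong:
  assumes "rows_at p q m B" "same_quiver (n - 1) B' B" "(p, q) = (1, 2) \<or> (p, q) = (2, 1)"
  shows "rows_at p q m B'"
proof -
  have "B' i j = B i j" if "i \<in> {1..n - 1}" "j \<in> {1..n - 1}" for i j
    using assms(2) that unfolding same_quiver_def by blast
  moreover have "p \<in> {1..n - 1}" "q \<in> {1..n - 1}" "\<And>j. j \<in> {3..<n} \<Longrightarrow> j \<in> {1..n - 1}"
    using assms(3) n by auto
  ultimately show ?thesis using assms(1) by (simp add: rows_at_def)
qed

lemma same_quiverI:
  assumes "quiver n B" "quiver n B'" "rows_at 2 1 m B" "rows_at 2 1 m B'"
    and "B 1 n = B' 1 n" "B 2 n = B' 2 n" "\<And>j. j \<in> {3..<n} \<Longrightarrow> B j n = B' j n"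
  shows "same_quiver n B B'"
proof -
  have lt: "B i j = B' i j" if "1 \<le> i" "i < j" "j \<le> n" for i j
    using n that
  proof (cases rule: quiver_cases_lt)
    case 5
    then consider "i = 1" | "i = 2" | "i \<in> {3..<n}" by force
    then show ?thesis using 5 assms by cases auto
  qed (use assms(3,4) in \<open>auto simp: rows_at_def\<close>)
  show ?thesis
    unfolding same_quiver_def
  proof (intro ballI)
    fix i j assume ij: "i \<in> {1..n}" "j \<in> {1..n}"
    have "B i j = - B j i" "B' i j = - B' j i" using assms(1,2) ij unfolding quiver_def by blast+
    then show "B i j = B' i j"
      using lt[of i j] lt[of j i] ij by (cases i j rule: linorder_cases) auto
  qed
qed

lemma special_cycle:
  assumes Q: "quiver n Q" "same_quiver (n - 1) Q (mutates (repeat_word k [2, 1]) R)"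
    and k: "k > 0" and Qn: "Q 1 n = v1" "Q 2 n = v2" "\<And>j. j \<in> {3..<n} \<Longrightarrow> Q j n \<ge> 2"
  shows "same_quiver n (mutates (special_sequence n k) Q) Q \<and>
    large_weights_along n Q (special_sequence n k)"
proof -
  \<comment> \<open>Since \<open>k > 0\<close>, the last pair 2, 1 can be split off. The preceding
    pairs number \<open>k'\<close>, and \<open>l\<close> counts their letters.\<close>
  obtain k' where k': "k = Suc k'" using k gr0_implies_Suc by blast
  define l where "l = 2 * k'"
  have l: "2 * k = Suc (Suc l)" by (simp add: l_def k')
  have skew: "B i j = - B j i" if "quiver n B" "i \<in> {1..n}" "j \<in> {1..n}" for B i j
    using that unfolding quiver_def by blast
  have UQ: "rows_at 2 1 (2 * k) Q"
    using rows_at_cong[OF rows_at_phase_up[OF rows_at_start] Q(2)] by simp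
  have lwQ: "large_weights n Q"
    by (rule rows_at_large[OF UQ _ Q(1)]) (use Qn v in force)+

  let ?B1 = "mutate n Q"
  have q1: "quiver n ?B1" using Q(1) n by (auto intro: quiver_mutate)
  have col: "Q i n \<ge> 0" if "i \<in> {1..n}" for i
  proof -
    consider "i = 1" | "i = 2" | "i \<in> {3..<n}" | "i = n" using \<open>i \<in> {1..n}\<close> by force
    then show ?thesis
    proof cases
      case 3
      from Qn(3)[OF this] show ?thesis by simp
    qed (use Qn(1,2) v quiver_diag[OF Q(1), of n] n in auto)
  qed
  \<comment> \<open>All arrows at \<open>n\<close> point to \<open>n\<close> in \<open>Q\<close>, so
    the first mutation is at a sink.\<close>
  have B1: "?B1 i j = flip {n} Q i j" if "i \<in> {1..n}" "j \<in> {1..n}" for i j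
    using mutate_sink[OF Q(1) _ col] that n unfolding same_quiver_def by force
  have U1: "rows_at 2 1 (2 * k) ?B1"
    by (rule rows_at_cong[OF UQ]) (use n in \<open>auto simp: same_quiver_def B1 flip_def\<close>)
  have V1: "column_at 2 1 0 (\<lambda>j. - Q j n) ?B1"
  proof -
    have "Q n 1 = - v1" "Q n 2 = - v2" "\<And>j. j \<in> {3..<n} \<Longrightarrow> Q n j = - Q j n"
      using skew[OF Q(1), of n] Qn n by auto
    then show ?thesis using n Qn by (simp add: column_at_def B1 flip_def E_def)
  qed
  have r1: "\<bar>- Q j n\<bar> \<ge> 2" if "j \<in> {3..<n}" for j using Qn(3)[OF that] by simp

  let ?B2 = "mutates (repeat_word k [1, 2]) ?B1"
  have U2: "rows_at 2 1 0 ?B2" and V2: "column_at 2 1 (2 * k) (\<lambda>j. - Q j n) ?B2"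
    and lw1: "large_weights_along n ?B1 (repeat_word k [1, 2])"
    using phase_down[OF U1 V1 q1 r1] by simp_all
  have q2: "quiver n ?B2"
    using repeat_word_pair[of 1 2 k] n by (intro quiver_mutates[OF q1]) force
  have lw2: "large_weights n ?B2" by (rule rows_column_large[OF U2 V2 _ q2 r1]) auto
  have B2: "?B2 1 2 = a" "?B2 1 n = - E (Suc (2 * k))" "?B2 2 n = E (2 * k)"
    "\<And>j. j \<in> {3..<n} \<Longrightarrow> ?B2 1 j = R 1 j \<and> ?B2 2 j = R 2 j \<and> ?B2 j n = - Q j n \<and> ?B2 n j = Q j n"
    "\<And>i j. i \<in> {3..<n} \<Longrightarrow> j \<in> {3..<n} \<Longrightarrow> ?B2 i j = R i j"
    using U2 V2 by (auto simp: rows_at_def column_at_def C_def)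

  let ?B3 = "mutates (rev [3..<n]) ?B2"
  have sinks: "same_quiver n ?B3 (flip {3..<n} ?B2) \<and> large_weights_along n ?B2 (rev [3..<n])"
  proof (rule mutates_sinks[OF q2 lw2])
    show "?B2 n j \<ge> 0" if "3 \<le> j" "j < n" for j
      using B2(4)[of j] Qn(3)[of j] that by auto
    show "?B2 i j \<ge> 0" if "1 \<le> i" "3 \<le> j" "j < n" "i < j" for i j
    proof -
      consider "i = 1" | "i = 2" | "i \<in> {3..<n}" using \<open>1 \<le> i\<close> \<open>i < j\<close> \<open>j < n\<close> by force
      moreover have "R i j \<ge> 2" using R(2) that by simp
      ultimately show ?thesis using B2(4)[of j] B2(5)[of i j] that by cases auto
    qed
  qed (use n in auto)
  have q3: "quiver n ?B3" by (rule quiver_mutates[OF q2]) auto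
  have B3': "?B3 i j = flip {3..<n} ?B2 i j" if "i \<in> {1..n}" "j \<in> {1..n}" for i j
    using sinks that unfolding same_quiver_def by blast
  have B3: "?B3 1 2 = a" "?B3 1 n = - E (Suc (Suc (Suc l)))" "?B3 2 n = E (Suc (Suc l))"
    using n B2(1-3) B3'[of 1 2] B3'[of 1 n] B3'[of 2 n] by (simp_all add: flip_def l)
  have B3j: "?B3 1 j = - R 1 j \<and> ?B3 2 j = - R 2 j \<and> ?B3 j n = Q j n" if "j \<in> {3..<n}" for j
    using that n B2(4)[OF that] by (auto simp: B3' flip_def)
  have B3ij: "?B3 i j = R i j" if "i \<in> {3..<n}" "j \<in> {3..<n}" for i j
    using that n B2(5)[OF that] by (auto simp: B3' flip_def)

  let ?B4 = "mutates [2, 1] ?B3"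
  let ?r = "\<lambda>j. Q j n + R 2 j * E (Suc (Suc l)) + R 1 j * E (Suc l)"
  have U4: "rows_at 2 1 0 ?B4" and V4: "column_at 2 1 l ?r ?B4" and lw3: "large_weights_along n ?B3 [2, 1]"
    and r4: "\<And>j. j \<in> {3..<n} \<Longrightarrow> ?r j \<ge> 2"
    using phase_middle[OF q3 B3 B3j B3ij Qn(3)] by blast+
  have q4: "quiver n ?B4" using n by (intro quiver_mutates[OF q3]) auto

  let ?B5 = "mutates (repeat_word k' [2, 1]) ?B4"
  have U5: "rows_at 2 1 l ?B5" using rows_at_phase_up[OF U4, of k'] by (simp add: l_def)
  have V5: "column_at 2 1 0 ?r ?B5" and lw4: "large_weights_along n ?B4 (repeat_word k' [2, 1])"
    using phase_up[OF U4 _ q4, of k' 0 ?r] V4 r4 by (force simp: l_def)+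
  have q5: "quiver n ?B5"
    using repeat_word_pair[of 2 1 k'] n by (intro quiver_mutates[OF q4]) force
  \<comment> \<open>The instance \<open>m = 0\<close> of \<open>recur_exchange\<close> rewrites the
    gain from \<open>phase_middle\<close> as the loss that \<open>phase_end\<close> will
    produce.\<close>
  have r5: "?r j = Q j n + C j (Suc (Suc l)) * v1 + C j (Suc l) * v2" if "j \<in> {3..<n}" for j
    using recur_exchange[of a "- R 1 j" "R 2 j" 0 "- v2" v1 "Suc l"]
    by (simp add: C_def E_def)

  let ?B6 = "mutates [2, 1] ?B5"
  note fin = phase_end[OF U5 V5 q5 r5 Qn(3)]
  have q6: "quiver n ?B6" using n by (intro quiver_mutates[OF q5]) auto
  have "same_quiver n ?B6 Q"
  proof (rule same_quiverI[OF q6 Q(1)])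
    show "rows_at 2 1 (2 * k) ?B6" using fin(1) unfolding l .
  qed (use UQ fin(2-4) Qn in auto)
  \<comment> \<open>The word is regrouped by phases: 2, 1 leaves the descending run, whose other
    letters are sinks, and the last repetition is cut off.\<close>
  moreover have seq: "special_sequence n k =
      [n] @ repeat_word k [1, 2] @ rev [3..<n] @ [2, 1] @ repeat_word k' [2, 1] @ [2, 1]"
  proof -
    have "[1..<n] = [1, 2] @ [3..<n]" using n by (simp add: upt_conv_Cons numeral_3_eq_3 numeral_2_eq_2 One_nat_def)
    moreover have "repeat_word k [2, 1] = repeat_word k' [2, 1] @ [2, 1]"
      unfolding k' by (rule repeat_word_Suc_right)
    ultimately show ?thesis by (simp add: special_sequence_def)
  qed
  moreover have "mutates (special_sequence n k) Q = ?B6"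
    unfolding seq by (simp add: mutates_append)
  moreover have "large_weights_along n Q [n]"
    using lwQ lw1 unfolding large_weights_along_Cons large_weights_along_Nil
    by (auto simp: large_weights_along_def)
  then have "large_weights_along n Q (special_sequence n k)"
    unfolding seq large_weights_along_append
    using lw1 sinks lw3 lw4 fin(5) by simp
  ultimately show ?thesis by simp
qed

end

theorem theorem9p1:
  fixes n :: nat and emb :: "'p::semifield \<Rightarrow> 'f::field"
  assumes "n \<ge> 2" and "ambient_field n emb"
  shows
    "(\<forall>Q ks x y.
        mutation_cycle n Q ks \<and> large_weights_along n Q ks \<and> is_seed n emb (x, y, Q) \<longrightarrow>
        \<not> same_seed n (seed_mutates n emb ks (x, y, Q)) (x, y, Q))
     \<and>
     (\<forall>k R Q.
        n \<ge> 4 \<and> k > 0 \<and>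
        quiver (n - 1) R \<and> (\<forall>i\<in>{1..n - 1}. \<forall>j\<in>{1..n - 1}. i < j \<longrightarrow> R i j \<ge> 2) \<and>
        quiver n Q \<and> same_quiver (n - 1) Q (mutates (repeat_word k [2, 1]) R) \<and>
        (\<forall>i\<in>{1..n - 1}. Q i n \<ge> 2) \<longrightarrow>
        mutation_cycle n Q (special_sequence n k) \<and>
        (\<forall>x y. is_seed n emb (x, y, Q) \<longrightarrow>
           \<not> same_seed n (seed_mutates n emb (special_sequence n k) (x, y, Q)) (x, y, Q)))"
proof (intro conjI allI impI)
  fix Q ks and x :: "nat \<Rightarrow> 'f" and y :: "nat \<Rightarrow> 'p"
  assume A: "mutation_cycle n Q ks \<and> large_weights_along n Q ks \<and> is_seed n emb (x, y, Q)"
  then have ks: "ks \<noteq> []" "set ks \<subseteq> {1..n}" "\<forall>m<length ks. ks ! m \<noteq> ks ! (Suc m mod length ks)"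
    unfolding mutation_cycle_def by auto
  have "ks ! m \<noteq> ks ! Suc m" if "Suc m < length ks" for m
    using ks(3)[rule_format, of m] that by simp
  then have "distinct_adj ks" by (simp add: distinct_adj_conv_nth)
  then show "\<not> same_seed n (seed_mutates n emb ks (x, y, Q)) (x, y, Q)"
    using no_seed_cycle assms A ks by blast
next
  fix k R Q
  assume A: "n \<ge> 4 \<and> k > 0 \<and>
        quiver (n - 1) R \<and> (\<forall>i\<in>{1..n - 1}. \<forall>j\<in>{1..n - 1}. i < j \<longrightarrow> R i j \<ge> 2) \<and>
        quiver n Q \<and> same_quiver (n - 1) Q (mutates (repeat_word k [2, 1]) R) \<and>
        (\<forall>i\<in>{1..n - 1}. Q i n \<ge> 2)"
  interpret two_vertex_cycle n R "Q 1 n" "Q 2 n"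
    by unfold_locales (use A in auto)
  have cyc: "same_quiver n (mutates (special_sequence n k) Q) Q"
    "large_weights_along n Q (special_sequence n k)"
  proof -
    have "Q j n \<ge> 2" if "j \<in> {3..<n}" for j using A that by auto
    with special_cycle[of Q k] A show "same_quiver n (mutates (special_sequence n k) Q) Q"
      "large_weights_along n Q (special_sequence n k)" by auto
  qed
  have adj: "distinct_adj (special_sequence n k)" "hd (special_sequence n k) \<noteq> last (special_sequence n k)"
    "set (special_sequence n k) \<subseteq> {1..n}" "special_sequence n k \<noteq> []"
    using special_sequence_adj[of n k] A by auto
  show "mutation_cycle n Q (special_sequence n k)"
    using cyc adj A assms(1) by (intro mutation_cycleI) auto
  fix x :: "nat \<Rightarrow> 'f" and y :: "nat \<Rightarrow> 'p"
  assume "is_seed n emb (x, y, Q)"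
  then show "\<not> same_seed n (seed_mutates n emb (special_sequence n k) (x, y, Q)) (x, y, Q)"
    using no_seed_cycle assms cyc adj by blast
qed

end
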